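(* Assume that $\epsilon:[t_0,+\infty)\to[0,+\infty)$ is nonincreasing and continuously differentiable with $\lim_{t\to+\infty}\epsilon(t)=0$, that $\beta:[t_0,+\infty)\to(0,+\infty)$ is nondecreasing and continuously differentiable, and that $\alpha>3$, $\frac{1}{\alpha-1}<\theta<\frac12$, $\rho>0$, $\Omega\neq\emptyset$. Assume moreover that $$\sup_{t\ge t_0}\frac{t\dot\beta(t)}{\beta(t)}<\frac{1-2\theta}{\theta},\qquad \int_{t_0}^{+\infty}t\beta(t)\epsilon(t)\,dt<+\infty .$$ Let $(x,\lambda):[t_0,+\infty)\to\mathcal X\times\mathcal Y$ be a solution of System (S). Then the trajectory $(x(t),\lambda(t))$ converges weakly in $\mathcal X\times\mathcal Y$, as $t\to+\infty$, to a primal-dual optimal solution of the problem $\min_{x\in\mathcal X}f(x)$ s.t. $Ax=b$, i.e. to an element of $\Omega$.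
   Context: $\mathcal X,\mathcal Y$ are real Hilbert spaces; $\mathcal X\times\mathcal Y$ carries the product inner product. $A:\mathcal X\to\mathcal Y$ is a continuous linear operator with adjoint $A^T$, $b\in\mathcal Y$, and $f:\mathcal X\to\mathbb R$ is convex and continuously differentiable with $\nabla f$ Lipschitz continuous with constant $L>0$. $\Omega$ is the set of saddle points of the Lagrangian $\mathcal L(x,\lambda)=f(x)+\langle\lambda,Ax-b\rangle$, i.e. $(x^*,\lambda^* )\in\Omega$ iff $\nabla f(x^* )+A^T\lambda^*=0$ and $Ax^*=b$; its elements are called primal-dual (optimal) solutions. System (S), for $t\ge t_0>0$: $$\ddot x(t)+\frac{\alpha}{t}\dot x(t)=-\beta(t)\left(\nabla f(x(t))+A^T(\lambda(t)+\theta t\dot\lambda(t))+\rho A^T(Ax(t)-b)+\epsilon(t)x(t)\right),$$ $$\ddot\lambda(t)+\frac{\alpha}{t}\dot\lambda(t)=\beta(t)\left(A(x(t)+\theta t\dot x(t))-b\right).$$ A solution is a global (twice continuously differentiable) solution on $[t_0,+\infty)$; the system is assumed throughout to admit a unique global solution for given initial data. *)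

theory Defs
  imports "HOL-Analysis.Analysis"
begin

definition lagrangian ::
  "('x::real_inner \<Rightarrow> real) \<Rightarrow> ('x \<Rightarrow> 'y::real_inner) \<Rightarrow> 'y \<Rightarrow> 'x \<Rightarrow> 'y \<Rightarrow> real" where
  "lagrangian f A b x l = f x + inner l (A x - b)"

definition saddle_points ::
  "('x::real_inner \<Rightarrow> real) \<Rightarrow> ('x \<Rightarrow> 'y::real_inner) \<Rightarrow> 'y \<Rightarrow> ('x \<times> 'y) set" where
  "saddle_points f A b = {(xs, ls).
     \<forall>x l. lagrangian f A b xs l \<le> lagrangian f A b xs ls
         \<and> lagrangian f A b xs ls \<le> lagrangian f A b x ls}"

text \<open>
  \<open>g\<close> is the gradient of the objective. The derivatives are taken relative to \<open>{t0..}\<close>, hence are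
  one-sided at \<open>t0\<close>; the values of the trajectory before \<open>t0\<close> are irrelevant.
\<close>

definition system_solution ::
  "real \<Rightarrow> real \<Rightarrow> real \<Rightarrow> real \<Rightarrow> (real \<Rightarrow> real) \<Rightarrow> (real \<Rightarrow> real) \<Rightarrow>
   ('x::real_inner \<Rightarrow> 'x) \<Rightarrow> ('x \<Rightarrow> 'y::real_inner) \<Rightarrow> 'y \<Rightarrow> (real \<Rightarrow> 'x) \<Rightarrow> (real \<Rightarrow> 'y) \<Rightarrow> bool" where
  "system_solution t0 \<alpha> \<theta> \<rho> \<beta> \<epsilon> g A b x l \<longleftrightarrow>
     (\<exists>x' x'' l' l''.
        continuous_on {t0..} x'' \<and> continuous_on {t0..} l'' \<and>
        (\<forall>t\<ge>t0.
           (x has_vector_derivative x' t) (at t within {t0..}) \<and>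
           (x' has_vector_derivative x'' t) (at t within {t0..}) \<and>
           (l has_vector_derivative l' t) (at t within {t0..}) \<and>
           (l' has_vector_derivative l'' t) (at t within {t0..}) \<and>
           x'' t + (\<alpha> / t) *\<^sub>R x' t =
             - (\<beta> t *\<^sub>R (g (x t) + adjoint A (l t + (\<theta> * t) *\<^sub>R l' t)
                         + \<rho> *\<^sub>R adjoint A (A (x t) - b) + \<epsilon> t *\<^sub>R x t)) \<and>
           l'' t + (\<alpha> / t) *\<^sub>R l' t =
             \<beta> t *\<^sub>R (A (x t + (\<theta> * t) *\<^sub>R x' t) - b)))"

definition weakly_tendsto ::
  "('i \<Rightarrow> 'z::real_normed_vector) \<Rightarrow> 'z \<Rightarrow> 'i filter \<Rightarrow> bool" where
  "weakly_tendsto z w F \<longleftrightarrow>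
     (\<forall>\<phi>::'z \<Rightarrow> real. bounded_linear \<phi> \<longrightarrow> ((\<lambda>i. \<phi> (z i)) \<longlongrightarrow> \<phi> w) F)"

text \<open>
  The library constant \<open>adjoint\<close> is defined by Hilbert choice, and the library proves its
  characteristic property only in the finite-dimensional case. The Riesz representation theorem
  yields it for bounded operators on a Hilbert space.
\<close>

lemma riesz_representation:
  fixes \<phi> :: "'a::{real_inner,complete_space} \<Rightarrow> real"
  assumes "bounded_linear \<phi>"
  obtains y where "\<And>x. \<phi> x = inner x y"
proof -
  interpret bounded_linear \<phi> by fact
  define J where "J u = inner u u / 2 - \<phi> u" for u
  obtain K where K: "\<And>x. norm (\<phi> x) \<le> norm x * K" using bounded by blast
  have lb: "J u \<ge> - (K^2 / 2)" for u
  proof -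
    have "\<phi> u \<le> norm u * K" using K[of u] by simp
    moreover have "0 \<le> (norm u - K)^2" by simp
    ultimately show ?thesis
      by (simp add: J_def power2_diff power2_norm_eq_inner[symmetric])
  qed
  define m where "m = (INF u. J u)"
  have bdd: "bdd_below (range J)" using lb by (auto intro!: bdd_belowI)
  have m_le: "m \<le> J u" for u unfolding m_def by (rule cINF_lower[OF bdd]) simp
  have "\<exists>u. J u < m + 1 / real (Suc n)" for n
  proof -
    have "(INF u. J u) < m + 1 / real (Suc n)" unfolding m_def by simp
    then show ?thesis using cINF_less_iff[OF _ bdd] by auto
  qed
  then obtain X where X: "\<And>n. J (X n) < m + 1 / real (Suc n)" by metis
  have par: "(dist u v)^2 \<le> 4 * (J u - m) + 4 * (J v - m)" for u v
  proof -
    have "J ((1/2) *\<^sub>R (u + v)) = J u / 2 + J v / 2 - (dist u v)^2 / 8"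
      unfolding J_def dist_norm power2_norm_eq_inner
      by (simp add: scaleR add inner_add_left inner_add_right inner_diff_left inner_diff_right
          inner_commute field_simps)
    with m_le[of "(1/2) *\<^sub>R (u + v)"] show ?thesis by simp
  qed
  have "Cauchy X"
  proof (rule metric_CauchyI)
    fix e :: real assume e: "e > 0"
    then obtain N where N: "1 / real (Suc N) < e^2 / 8"
      using reals_Archimedean[of "e^2/8"] by (auto simp: inverse_eq_divide)
    have "dist (X i) (X j) < e" if "i \<ge> N" "j \<ge> N" for i j
    proof -
      have "1 / real (Suc k) \<le> 1 / real (Suc N)" if "k \<ge> N" for k
        using that by (simp add: frac_le)
      then have J: "J (X k) - m < e^2/8" if "k \<ge> N" for k using X[of k] N that by fastforce
      note par[of "X i" "X j"]
      also have "4 * (J (X i) - m) + 4 * (J (X j) - m) < 4 * (e^2/8) + 4 * (e^2/8)"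
        using J[OF that(1)] J[OF that(2)] by (intro add_strict_mono mult_strict_left_mono) auto
      also have "\<dots> = e^2" by simp
      finally have "(dist (X i) (X j))^2 < e^2" .
      then show ?thesis using e by (simp add: power_less_imp_less_base)
    qed
    then show "\<exists>M. \<forall>i\<ge>M. \<forall>j\<ge>M. dist (X i) (X j) < e" by blast
  qed
  then obtain y where y: "X \<longlonglongrightarrow> y" using Cauchy_convergent convergent_def by blast
  have "(\<lambda>n. J (X n)) \<longlonglongrightarrow> J y"
    unfolding J_def by (intro tendsto_intros y tendsto) simp
  moreover have "(\<lambda>n. m + 1 / real (Suc n)) \<longlonglongrightarrow> m + 0"
    by (intro tendsto_intros) (use LIMSEQ_inverse_real_of_nat in \<open>simp add: inverse_eq_divide\<close>)
  ultimately have "J y \<le> m + 0"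
    by (rule LIMSEQ_le) (use X in \<open>auto intro: less_imp_le\<close>)
  then have min: "J y \<le> J u" for u using m_le[of u] by simp
  have "\<phi> h = inner h y" for h
  proof (cases "h = 0")
    case False
    define d where "d = inner h y - \<phi> h"
    define q where "q = inner h h"
    have q: "q > 0" using False by (simp add: q_def)
    have Js: "J (y + s *\<^sub>R h) = J y + s * d + s^2 * q / 2" for s
      unfolding J_def d_def q_def
      by (simp add: scaleR add inner_add_left inner_add_right inner_commute field_simps
          power2_eq_square)
    have "0 \<le> (- d / q) * d + (- d / q)^2 * q / 2"
      using min[of "y + (- d / q) *\<^sub>R h"] unfolding Js by linarith
    also have "\<dots> = - (d^2 / (2 * q))" using q by (simp add: field_simps power2_eq_square)
    finally have "d^2 \<le> 0" using q by (simp add: field_simps)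
    then show ?thesis by (simp add: d_def)
  qed (simp add: zero)
  then show thesis using that by blast
qed

lemma adjoint_hilbert:
  fixes A :: "'x::{real_inner,complete_space} \<Rightarrow> 'y::real_inner"
  assumes "bounded_linear A"
  shows "inner (A x) y = inner x (adjoint A y)"
proof -
  have "\<exists>z. \<forall>x. inner (A x) y = inner x z" for y
  proof -
    have "bounded_linear (\<lambda>x. inner (A x) y)"
      using assms bounded_linear_compose bounded_linear_inner_left by blast
    from riesz_representation[OF this] show ?thesis by metis
  qed
  then have "\<exists>B. \<forall>x y. inner (A x) y = inner x (B y)" by metis
  then have "\<forall>x y. inner (A x) y = inner x (adjoint A y)"
    unfolding adjoint_def by (rule someI_ex)
  then show ?thesis by blast
qed

lemma saddle_points_iff_KKT:
  fixes f :: "'x::{real_inner,complete_space} \<Rightarrow> real" and A :: "'x \<Rightarrow> 'y::real_inner"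
  assumes A: "bounded_linear A" and f: "convex_on UNIV f" and g: "\<And>x. GDERIV f x :> g x"
  shows "(xs, ls) \<in> saddle_points f A b \<longleftrightarrow> g xs + adjoint A ls = 0 \<and> A xs = b"
proof -
  interpret A: bounded_linear A by fact
  have der: "((\<lambda>s. f (xs + s *\<^sub>R h)) has_real_derivative inner h (g xs)) (at 0)" for h
  proof -
    have "(f has_derivative (\<lambda>h. inner h (g xs))) (at (xs + 0 *\<^sub>R h))"
      using g[of xs] by (simp add: gderiv_def)
    moreover have "((\<lambda>s. xs + s *\<^sub>R h) has_derivative (\<lambda>s. s *\<^sub>R h)) (at 0)"
      by (auto intro!: derivative_eq_intros)
    ultimately have "((\<lambda>s. f (xs + s *\<^sub>R h)) has_derivative (\<lambda>s. inner (s *\<^sub>R h) (g xs))) (at 0)"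
      using has_derivative_compose[of "\<lambda>s. xs + s *\<^sub>R h"] by blast
    then show ?thesis by (simp add: has_field_derivative_def mult_commute_abs)
  qed
  show ?thesis
  proof
    assume S: "(xs, ls) \<in> saddle_points f A b"
    then have mx: "lagrangian f A b xs l \<le> lagrangian f A b xs ls"
      and mn: "lagrangian f A b xs ls \<le> lagrangian f A b x ls" for x l
      by (auto simp: saddle_points_def)
    have "inner (A xs - b) (A xs - b) \<le> 0"
      using mx[of "ls + (A xs - b)"] by (simp add: lagrangian_def inner_add_left)
    then have feas: "A xs = b"
      by (metis eq_iff_diff_eq_0 inner_ge_zero inner_eq_zero_iff order_antisym)
    have "inner h (g xs + adjoint A ls) = 0" for h
    proof -
      have "((\<lambda>s. lagrangian f A b (xs + s *\<^sub>R h) ls) has_real_derivative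
              inner h (g xs) + inner ls (A h)) (at 0)"
        unfolding lagrangian_def
        by (auto intro!: derivative_eq_intros der simp: A.add A.scaleR inner_simps)
      from DERIV_local_min[OF this zero_less_one] mn
      have "inner h (g xs) + inner ls (A h) = 0" by simp
      then show ?thesis
        using adjoint_hilbert[OF A, of h ls] by (simp add: inner_add_right inner_commute)
    qed
    from this[of "g xs + adjoint A ls"] feas
    show "g xs + adjoint A ls = 0 \<and> A xs = b" by simp
  next
    assume KKT: "g xs + adjoint A ls = 0 \<and> A xs = b"
    have "lagrangian f A b xs ls \<le> lagrangian f A b x ls" for x
    proof -
      let ?h = "x - xs"
      have "convex_on UNIV (\<lambda>s::real. f (xs + s *\<^sub>R ?h))"
      proof (rule convex_onI)
        fix t u v :: real assume "0 < t" "t < 1"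
        have eq: "xs + ((1 - t) *\<^sub>R u + t *\<^sub>R v) *\<^sub>R ?h
              = (1 - t) *\<^sub>R (xs + u *\<^sub>R ?h) + t *\<^sub>R (xs + v *\<^sub>R ?h)"
          by (simp add: algebra_simps)
        show "f (xs + ((1 - t) *\<^sub>R u + t *\<^sub>R v) *\<^sub>R ?h)
              \<le> (1 - t) * f (xs + u *\<^sub>R ?h) + t * f (xs + v *\<^sub>R ?h)"
          unfolding eq using convex_onD[OF f] \<open>0 < t\<close> \<open>t < 1\<close> by simp
      qed simp
      from convex_on_imp_above_tangent[OF this, of 0 1 "inner ?h (g xs)"] der[of ?h]
      have "f x - f xs \<ge> inner ?h (g xs)" by simp
      moreover have "inner ?h (g xs) + inner ?h (adjoint A ls) = 0"
        using KKT by (simp flip: inner_add_right)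
      moreover have "inner ?h (adjoint A ls) = inner ls (A x - b)"
        using adjoint_hilbert[OF A, of ?h ls] KKT by (simp add: A.diff inner_commute)
      ultimately show ?thesis using KKT by (simp add: lagrangian_def)
    qed
    then show "(xs, ls) \<in> saddle_points f A b"
      using KKT by (auto simp: saddle_points_def lagrangian_def)
  qed
qed

end

theory Submission
  imports Defs
begin

text \<open>
  For a primal-dual solution \<open>(x*, \<lambda>*)\<close> put \<open>h = (|x - x*|\<^sup>2 + |\<lambda> - \<lambda>*|\<^sup>2) / 2\<close> and
  \<open>\<xi> = \<theta> (\<alpha> - 1) - 1 > 0\<close>. The energy
  \<open>E = \<theta>\<^sup>2 t\<^sup>2 \<beta> \<Phi> + (|x - x* + \<theta> t x'|\<^sup>2 + |\<lambda> - \<lambda>* + \<theta> t \<lambda>'|\<^sup>2) / 2 + \<xi> h\<close>, where \<open>\<Phi>\<close> is the gap of the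
  augmented Lagrangian plus the Tikhonov term, decreases up to the integrable error \<open>c t \<beta> \<epsilon>\<close>, at a
  rate that dominates \<open>W = t (|x'|\<^sup>2 + |\<lambda>'|\<^sup>2) / 2 + t \<beta> \<Phi>\<close>. Hence \<open>E\<close> converges, \<open>W\<close> is integrable,
  \<open>A x \<rightarrow> b\<close> and \<open>\<nabla>f(x) \<rightarrow> \<nabla>f(x*)\<close> strongly. As \<open>E = (1 + \<xi>) h + \<theta> t h' + \<theta>\<^sup>2 t W\<close>, the distance \<open>h\<close>
  converges too. Averaging the primal equation shows that the adjoint of \<open>A\<close> applied to \<open>\<lambda> - \<lambda>*\<close>
  tends weakly to zero, so weak cluster points are primal-dual solutions and Opial's lemma applies.
\<close>

section \<open>Weak convergence in Hilbert spaces\<close>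

text \<open>By Riesz representation, inner products with fixed vectors exhaust the bounded
  functionals.\<close>

lemma weakly_tendsto_iff_inner:
  fixes z :: "'i \<Rightarrow> 'a::{real_inner,complete_space}"
  shows "weakly_tendsto z w F \<longleftrightarrow> (\<forall>y. ((\<lambda>i. inner (z i) y) \<longlongrightarrow> inner w y) F)"
proof
  assume "weakly_tendsto z w F"
  then show "\<forall>y. ((\<lambda>i. inner (z i) y) \<longlongrightarrow> inner w y) F"
    unfolding weakly_tendsto_def using bounded_linear_inner_left by blast
next
  assume R: "\<forall>y. ((\<lambda>i. inner (z i) y) \<longlongrightarrow> inner w y) F"
  show "weakly_tendsto z w F"
    unfolding weakly_tendsto_def
  proof (intro allI impI)
    fix \<phi> :: "'a \<Rightarrow> real" assume "bounded_linear \<phi>"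
    then obtain y where "\<And>x. \<phi> x = inner x y" using riesz_representation by blast
    then show "((\<lambda>i. \<phi> (z i)) \<longlongrightarrow> \<phi> w) F" using R by simp
  qed
qed

text \<open>
  Working with a finer filter instead of a subsequence, weak compactness of balls reduces to
  Tychonoff's theorem for the functionals \<open>inner (z i)\<close>, with no separability argument.
\<close>

lemma weak_cluster_point:
  fixes z :: "'i \<Rightarrow> 'a::{real_inner,complete_space}"
  assumes F: "F \<noteq> bot" and bdd: "\<forall>\<^sub>F i in F. norm (z i) \<le> K"
  obtains G w where "G \<noteq> bot" "G \<le> F" "weakly_tendsto z w G"
proof -
  define \<iota> where "\<iota> i = (\<lambda>y. inner (z i) y)" for i
  \<comment> \<open>Cauchy-Schwarz confines the coordinate at \<open>y\<close> to this interval, so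
    Tychonoff applies to the box.\<close>
  define C where "C = PiE UNIV (\<lambda>y::'a. {- (K * norm y)..K * norm y})"
  have "compactin (product_topology (\<lambda>i. euclidean) UNIV) C"
    unfolding C_def compactin_PiE by auto
  then have "compact C" by (simp add: euclidean_product_topology)
  moreover have "filtermap \<iota> F \<noteq> bot" using F by (simp add: filtermap_bot_iff)
  moreover have "eventually (\<lambda>h. h \<in> C) (filtermap \<iota> F)"
    unfolding eventually_filtermap using bdd
  proof eventually_elim
    case (elim i)
    have "\<bar>inner (z i) y\<bar> \<le> K * norm y" for y
      using Cauchy_Schwarz_ineq2[of "z i" y] mult_right_mono[OF elim, of "norm y"] by simp
    then show ?case by (auto simp: C_def \<iota>_def abs_le_iff minus_le_iff)
  qed
  ultimately obtain p where p: "p \<in> C" "inf (nhds p) (filtermap \<iota> F) \<noteq> bot"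
    unfolding compact_filter by blast
  \<comment> \<open>Pulling the neighbourhoods of \<open>p\<close> back along \<open>\<iota>\<close>
    gives a filter on indices; it is proper because \<open>p\<close> is a cluster point of the image
    filter.\<close>
  define G where "G = inf (filtercomap \<iota> (nhds p)) F"
  have G: "G \<noteq> bot"
  proof
    assume "G = bot"
    then have "eventually (\<lambda>_. False) G" by simp
    then obtain Q R where Q: "eventually Q (filtercomap \<iota> (nhds p))" and R: "eventually R F"
      and QR: "\<And>i. Q i \<Longrightarrow> R i \<Longrightarrow> False"
      unfolding G_def eventually_inf by blast
    from Q obtain Q' where Q': "eventually Q' (nhds p)" "\<And>i. Q' (\<iota> i) \<Longrightarrow> Q i"
      unfolding eventually_filtercomap by blast
    have "eventually (\<lambda>h. \<exists>i. h = \<iota> i \<and> R i) (filtermap \<iota> F)"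
      unfolding eventually_filtermap using R by eventually_elim auto
    with Q' QR have "eventually (\<lambda>_. False) (inf (nhds p) (filtermap \<iota> F))"
      unfolding eventually_inf by blast
    with p(2) show False by (simp add: trivial_limit_def)
  qed
  have "G \<le> filtercomap \<iota> (nhds p)" by (simp add: G_def)
  then have lim_\<iota>: "(\<iota> \<longlongrightarrow> p) G"
    by (simp add: filterlim_iff_le_filtercomap)
  have lim: "((\<lambda>i. inner (z i) y) \<longlongrightarrow> p y) G" for y
  proof (rule topological_tendstoI)
    fix S :: "real set" assume S: "open S" "p y \<in> S"
    have "open ((\<lambda>h::'a \<Rightarrow> real. h y) -` S)"
      by (rule open_vimage[OF S(1) continuous_on_product_coordinates])
    from topological_tendstoD[OF lim_\<iota> this] S(2)
    show "\<forall>\<^sub>F i in G. inner (z i) y \<in> S" by (simp add: \<iota>_def)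
  qed
  \<comment> \<open>Linearity and the bound \<open>K\<close> pass to the pointwise limit; Riesz then
    provides the weak limit.\<close>
  have "bounded_linear p"
  proof (rule bounded_linear_intro)
    fix u v :: 'a and c :: real
    show "p (u + v) = p u + p v"
    proof (rule tendsto_unique[OF G lim])
      show "((\<lambda>i. inner (z i) (u + v)) \<longlongrightarrow> p u + p v) G"
        unfolding inner_add_right by (intro tendsto_intros lim)
    qed
    show "p (c *\<^sub>R u) = c *\<^sub>R p u"
    proof (rule tendsto_unique[OF G lim])
      show "((\<lambda>i. inner (z i) (c *\<^sub>R u)) \<longlongrightarrow> c *\<^sub>R p u) G"
        unfolding inner_scaleR_right real_scaleR_def by (intro tendsto_intros lim)
    qed
    have "p u \<in> {- (K * norm u)..K * norm u}" using p(1) by (auto simp: C_def)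
    then show "norm (p u) \<le> norm u * K" by (auto simp: mult.commute)
  qed
  then obtain w where w: "\<And>y. p y = inner y w" using riesz_representation by blast
  have "weakly_tendsto z w G"
    unfolding weakly_tendsto_iff_inner using lim by (simp add: w inner_commute)
  moreover have "G \<le> F" by (simp add: G_def)
  ultimately show thesis using that G by blast
qed

text \<open>Convergent distances bound \<open>z\<close>, so weak cluster points exist, and they lie
  in \<open>S\<close>. There is only one, because \<open>inner (z i) (w' - w)\<close> converges
  along all of \<open>F\<close>; a bounded family with a single weak cluster point converges
  weakly.\<close>

lemma opial:
  fixes z :: "'i \<Rightarrow> 'a::{real_inner,complete_space}"
  assumes F: "F \<noteq> bot" and S: "S \<noteq> {}"
    and dist: "\<And>w. w \<in> S \<Longrightarrow> \<exists>r. ((\<lambda>i. (norm (z i - w))\<^sup>2) \<longlongrightarrow> r) F"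
    and cluster: "\<And>G w. G \<noteq> bot \<Longrightarrow> G \<le> F \<Longrightarrow> weakly_tendsto z w G \<Longrightarrow> w \<in> S"
  shows "\<exists>w\<in>S. weakly_tendsto z w F"
proof -
  obtain s where s: "s \<in> S" using S by blast
  obtain r where r: "((\<lambda>i. (norm (z i - s))\<^sup>2) \<longlongrightarrow> r) F" using dist[OF s] by blast
  have bdd: "\<forall>\<^sub>F i in F. norm (z i) \<le> sqrt (r + 1) + norm s"
    using order_tendstoD(2)[OF r, of "r + 1", simplified]
  proof eventually_elim
    case (elim i)
    then have "norm (z i - s) \<le> sqrt (r + 1)" by (intro real_le_rsqrt) simp
    then show ?case using norm_triangle_ineq[of "z i - s" s] by simp
  qed
  obtain G w where G: "G \<noteq> bot" "G \<le> F" and w: "weakly_tendsto z w G"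
    using weak_cluster_point[OF F bdd] by blast
  have wS: "w \<in> S" using cluster G w by blast
  have uniq: "w' = w" if G': "G' \<noteq> bot" "G' \<le> F" "weakly_tendsto z w' G'" for G' w'
  proof -
    have "w' \<in> S" using cluster G' by blast
    then obtain r1 r2 where r: "((\<lambda>i. (norm (z i - w))\<^sup>2) \<longlongrightarrow> r1) F"
        "((\<lambda>i. (norm (z i - w'))\<^sup>2) \<longlongrightarrow> r2) F"
      using dist wS by meson
    \<comment> \<open>By polarization, the difference of the two squared distances determines
      \<open>inner (z i) (w' - w)\<close>, whose limit this is.\<close>
    define m where "m = (r1 - r2 + (norm w')\<^sup>2 - (norm w)\<^sup>2) / 2"
    have "inner (z i) (w' - w)
        = ((norm (z i - w))\<^sup>2 - (norm (z i - w'))\<^sup>2 + (norm w')\<^sup>2 - (norm w)\<^sup>2) / 2" for i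
      by (simp add: power2_norm_eq_inner inner_diff_left inner_diff_right inner_commute)
    moreover have "((\<lambda>i. ((norm (z i - w))\<^sup>2 - (norm (z i - w'))\<^sup>2 + (norm w')\<^sup>2 - (norm w)\<^sup>2) / 2)
        \<longlongrightarrow> m) F"
      unfolding m_def by (intro tendsto_intros r) simp
    ultimately have m: "((\<lambda>i. inner (z i) (w' - w)) \<longlongrightarrow> m) F" by presburger
    have "inner w (w' - w) = m"
      using w tendsto_unique[OF G(1) _ tendsto_mono[OF G(2) m]]
      by (simp add: weakly_tendsto_iff_inner)
    moreover have "inner w' (w' - w) = m"
      using G'(3) tendsto_unique[OF G'(1) _ tendsto_mono[OF G'(2) m]]
      by (simp add: weakly_tendsto_iff_inner)
    ultimately have "inner (w' - w) (w' - w) = 0" by (simp add: inner_diff_left)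
    then show ?thesis by simp
  qed
  have "weakly_tendsto z w F"
    unfolding weakly_tendsto_iff_inner tendsto_iff
  proof (intro allI impI, rule ccontr)
    fix y and e :: real
    assume e: "e > 0" and not_ev: "\<not> (\<forall>\<^sub>F i in F. dist (inner (z i) y) (inner w y) < e)"
    \<comment> \<open>The violating indices carry a cluster point of their own, which uniqueness
      identifies with \<open>w\<close>.\<close>
    define N where "N = {i. \<not> dist (inner (z i) y) (inner w y) < e}"
    have F': "inf F (principal N) \<noteq> bot"
      using not_ev by (auto simp: trivial_limit_def eventually_inf_principal N_def)
    have "\<forall>\<^sub>F i in inf F (principal N). norm (z i) \<le> sqrt (r + 1) + norm s"
      using bdd by (rule filter_leD[rotated]) simp
    then obtain G' w' where G': "G' \<noteq> bot" "G' \<le> inf F (principal N)" "weakly_tendsto z w' G'"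
      using weak_cluster_point[OF F'] by blast
    then have "w' = w" by (intro uniq) auto
    then have "((\<lambda>i. inner (z i) y) \<longlongrightarrow> inner w y) G'"
      using G' by (simp add: weakly_tendsto_iff_inner)
    then have "\<forall>\<^sub>F i in G'. dist (inner (z i) y) (inner w y) < e"
      using e by (simp add: tendsto_iff)
    moreover have "\<forall>\<^sub>F i in G'. i \<in> N"
      using G'(2) by (simp add: le_principal)
    ultimately have "\<forall>\<^sub>F i in G'. False" by eventually_elim (simp add: N_def)
    with G'(1) show False by (simp add: trivial_limit_def)
  qed
  with wS show ?thesis by blast
qed

section \<open>Limits at infinity of functions of one real variable\<close>

lemma bounded_nondecreasing_tendsto:
  fixes h h' :: "real \<Rightarrow> real"
  assumes der: "\<And>t. t \<ge> T \<Longrightarrow> (h has_real_derivative h' t) (at t)"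
    and nonneg: "\<And>t. t \<ge> T \<Longrightarrow> h' t \<ge> 0"
    and bdd: "\<And>t. t \<ge> T \<Longrightarrow> h t \<le> K"
  shows "\<exists>m. (h \<longlongrightarrow> m) at_top"
proof -
  have mono: "h s \<le> h t" if "T \<le> s" "s \<le> t" for s t
    using that by (intro DERIV_nonneg_imp_nondecreasing[of s t h])
      (auto intro!: exI[of _ "h' _"] der nonneg)
  have B: "bdd_above (h ` {T..})" using bdd by (auto intro!: bdd_aboveI)
  have "(h \<longlongrightarrow> (SUP t\<in>{T..}. h t)) at_top"
  proof (rule increasing_tendsto)
    show "\<forall>\<^sub>F t in at_top. h t \<le> (SUP t\<in>{T..}. h t)"
      using eventually_ge_at_top[of T] by eventually_elim (auto intro!: cSUP_upper B)
    fix y assume "y < (SUP t\<in>{T..}. h t)"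
    then obtain s where s: "s \<ge> T" "y < h s" using less_cSUP_iff[OF _ B] by auto
    show "\<forall>\<^sub>F t in at_top. y < h t"
      using eventually_ge_at_top[of s] by eventually_elim (use s mono in force)
  qed
  then show ?thesis by blast
qed

lemma antiderivative_at_top:
  fixes h :: "real \<Rightarrow> real"
  assumes "continuous_on {T..} h"
  obtains H where "\<And>t. t > T \<Longrightarrow> (H has_real_derivative h t) (at t)"
proof
  fix t assume t: "t > T"
  have "continuous_on {T..t + 1} h" by (rule continuous_on_subset[OF assms]) auto
  then have "((\<lambda>u. integral {T..u} h) has_real_derivative h t) (at t within {T..t + 1})"
    using t by (intro integral_has_real_derivative) auto
  then show "((\<lambda>u. integral {T..u} h) has_real_derivative h t) (at t)"
    using t at_within_Icc_at[of T t "t + 1"] by simp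
qed

text \<open>With the integrating factor \<open>t powr p\<close>, \<open>p = c / \<theta>\<close>,
  the given combination divided by \<open>c\<close> is the quotient of the derivatives of
  \<open>t powr p * u t\<close> and \<open>t powr p\<close>; L'Hospital's rule gives the
  limit.\<close>

lemma ODE_tendsto:
  fixes u u' :: "real \<Rightarrow> real"
  assumes c: "c > 0" and \<theta>: "\<theta> > 0"
    and der: "\<And>t. t \<ge> T \<Longrightarrow> (u has_real_derivative u' t) (at t)"
    and lim: "((\<lambda>t. \<theta> * t * u' t + c * u t) \<longlongrightarrow> m) at_top"
  shows "(u \<longlongrightarrow> m / c) at_top"
proof -
  define p where "p = c / \<theta>"
  have p: "p > 0" using c \<theta> by (simp add: p_def)
  have ev: "\<forall>\<^sub>F t in at_top. t > 0 \<and> t \<ge> T"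
    using eventually_gt_at_top[of 0] eventually_ge_at_top[of T] by eventually_elim auto
  have "((\<lambda>t. (t powr p * u t) / t powr p) \<longlongrightarrow> m / c) at_top"
  proof (rule lhospital_at_top_at_top)
    have "filterlim (\<lambda>t. exp (p * ln t)) at_top at_top"
      by (rule filterlim_compose[OF exp_at_top
            filterlim_tendsto_pos_mult_at_top[OF tendsto_const p ln_at_top]])
    moreover have "\<forall>\<^sub>F t in at_top. exp (p * ln t) = t powr p"
      using ev by eventually_elim (simp add: powr_def)
    ultimately show "filterlim (\<lambda>t. t powr p) at_top at_top"
      by (simp add: filterlim_cong)
    show "\<forall>\<^sub>F t in at_top. p * t powr (p - 1) \<noteq> 0"
      using ev by eventually_elim (use p in auto)
    show "\<forall>\<^sub>F t in at_top. ((\<lambda>t. t powr p * u t) has_real_derivative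
        p * t powr (p - 1) * u t + t powr p * u' t) (at t)"
      using ev by eventually_elim (auto intro!: derivative_eq_intros der)
    show "\<forall>\<^sub>F t in at_top. ((\<lambda>t. t powr p) has_real_derivative p * t powr (p - 1)) (at t)"
      using ev by eventually_elim (auto intro!: derivative_eq_intros)
    have "\<forall>\<^sub>F t in at_top. (\<theta> * t * u' t + c * u t) / c
        = (p * t powr (p - 1) * u t + t powr p * u' t) / (p * t powr (p - 1))"
      using ev
    proof eventually_elim
      case (elim t)
      then have "t powr p = t * t powr (p - 1)" by (simp add: powr_mult_base)
      then show ?case using elim p c \<theta> by (simp add: p_def field_simps)
    qed
    then show "((\<lambda>t. (p * t powr (p - 1) * u t + t powr p * u' t) / (p * t powr (p - 1)))
        \<longlongrightarrow> m / c) at_top"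
      using tendsto_divide[OF lim tendsto_const[of c]] c by (simp add: tendsto_cong)
  qed
  moreover have "\<forall>\<^sub>F t in at_top. (t powr p * u t) / t powr p = u t"
    using ev by eventually_elim auto
  ultimately show ?thesis by (simp add: tendsto_cong)
qed

text \<open>Turns a finite Lebesgue integral into a bounded antiderivative, the form that the energy
  estimate uses. Starting the bound at \<open>T + 1\<close> leaves room for two-sided
  derivatives.\<close>

lemma nn_integral_antiderivative_bounded:
  fixes k :: "real \<Rightarrow> real"
  assumes cont: "continuous_on {T..} k" and nonneg: "\<And>t. t \<ge> T \<Longrightarrow> k t \<ge> 0"
    and fin: "(\<integral>\<^sup>+t\<in>{T..}. ennreal (k t) \<partial>lborel) < \<infinity>"
  obtains P K where "\<And>t. t > T \<Longrightarrow> (P has_real_derivative k t) (at t)"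
    and "\<And>t. t \<ge> T + 1 \<Longrightarrow> P t \<le> K"
proof -
  let ?I = "\<integral>\<^sup>+t\<in>{T..}. ennreal (k t) \<partial>lborel"
  obtain P where P: "\<And>t. t > T \<Longrightarrow> (P has_real_derivative k t) (at t)"
    using antiderivative_at_top[OF cont] by blast
  have "P t \<le> P (T + 1) + enn2real ?I" if t: "t \<ge> T + 1" for t
  proof -
    have "(\<lambda>s. indicator {T..} s *\<^sub>R k s) \<in> borel_measurable borel"
      by (intro borel_measurable_continuous_on_indicator cont) simp
    from nn_integral_FTC_Icc[OF this, of "T + 1" t P] have
      "ennreal (P t - P (T + 1))
        = (\<integral>\<^sup>+s. ennreal (indicator {T..} s *\<^sub>R k s) * indicator {T + 1..t} s \<partial>lborel)"
      using P nonneg t by simp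
    also have "\<dots> \<le> ?I"
      by (intro nn_integral_mono) (auto split: split_indicator)
    finally have "enn2real (ennreal (P t - P (T + 1))) \<le> enn2real ?I"
      using fin by (intro enn2real_mono) auto
    \<comment> \<open>\<open>ennreal\<close> truncates negative numbers to 0, so the inequality
      holds for either sign.\<close>
    moreover have "P t - P (T + 1) \<le> enn2real (ennreal (P t - P (T + 1)))"
      by (cases "P t - P (T + 1) \<ge> 0") (simp_all add: order_trans[OF _ enn2real_nonneg])
    ultimately show ?thesis by linarith
  qed
  with P show thesis by (rule that)
qed

section \<open>Convex functions with Lipschitz gradient\<close>

text \<open>Restriction to the line through \<open>u\<close> and \<open>v\<close> reduces this to
  the tangent inequality in one real variable.\<close>

lemma gradient_inequality:
  fixes f :: "'a::real_inner \<Rightarrow> real"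
  assumes f: "convex_on UNIV f" and g: "GDERIV f u :> g"
  shows "f u + inner g (v - u) \<le> f v"
proof -
  let ?h = "v - u"
  have "(f has_derivative (\<lambda>h. inner h g)) (at (u + 0 *\<^sub>R ?h))"
    using g by (simp add: gderiv_def)
  moreover have "((\<lambda>s. u + s *\<^sub>R ?h) has_derivative (\<lambda>s. s *\<^sub>R ?h)) (at (0::real))"
    by (auto intro!: derivative_eq_intros)
  ultimately have "((\<lambda>s. f (u + s *\<^sub>R ?h)) has_derivative (\<lambda>s. inner (s *\<^sub>R ?h) g)) (at (0::real))"
    using has_derivative_compose[of "\<lambda>s. u + s *\<^sub>R ?h"] by blast
  then have der: "((\<lambda>s. f (u + s *\<^sub>R ?h)) has_real_derivative inner ?h g) (at 0)"
    by (simp add: has_field_derivative_def mult_commute_abs)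
  have "convex_on UNIV (\<lambda>s::real. f (u + s *\<^sub>R ?h))"
  proof (rule convex_onI)
    fix t a b :: real assume "0 < t" "t < 1"
    have eq: "u + ((1 - t) *\<^sub>R a + t *\<^sub>R b) *\<^sub>R ?h
          = (1 - t) *\<^sub>R (u + a *\<^sub>R ?h) + t *\<^sub>R (u + b *\<^sub>R ?h)"
      by (simp add: algebra_simps)
    show "f (u + ((1 - t) *\<^sub>R a + t *\<^sub>R b) *\<^sub>R ?h)
          \<le> (1 - t) * f (u + a *\<^sub>R ?h) + t * f (u + b *\<^sub>R ?h)"
      unfolding eq using convex_onD[OF f] \<open>0 < t\<close> \<open>t < 1\<close> by simp
  qed simp
  from convex_on_imp_above_tangent[OF this, of 0 1 "inner ?h g"] der
  show ?thesis by (simp add: inner_commute)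
qed

definition bregman :: "('a::real_inner \<Rightarrow> real) \<Rightarrow> ('a \<Rightarrow> 'a) \<Rightarrow> 'a \<Rightarrow> 'a \<Rightarrow> real" where
  "bregman f g v u = f v - f u - inner (g u) (v - u)"

text \<open>Lets a vanishing Bregman distance force convergence of gradients. The constant
  \<open>4 * L\<close>, twice the sharp one, comes from the shorter step.\<close>

lemma bregman_bound_gradient:
  fixes f :: "'a::real_inner \<Rightarrow> real"
  assumes f: "convex_on UNIV f" and g: "\<And>u. GDERIV f u :> g u"
    and L: "L > 0" "lipschitz_on L UNIV g"
  shows "(norm (g v - g u))\<^sup>2 \<le> 4 * L * bregman f g v u"
proof -
  define d where "d = g v - g u"
  \<comment> \<open>a gradient step of half the usual length, for which tangent inequalities alone suffice\<close>
  define w where "w = v - (1 / (2 * L)) *\<^sub>R d"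
  have "norm (g v - g w) \<le> L * norm (v - w)"
    using lipschitz_onD[OF L(2), of v w] by (simp add: dist_norm)
  also have "\<dots> = norm d / 2" using L(1) by (simp add: w_def)
  finally have "norm (g v - g w) * norm d \<le> norm d / 2 * norm d" by (intro mult_right_mono) auto
  then have "inner (g v - g w) d \<le> norm d / 2 * norm d"
    using Cauchy_Schwarz_ineq2[of "g v - g w" d] by linarith
  moreover have "norm d * norm d = inner d d" by (simp add: power2_norm_eq_inner flip: power2_eq_square)
  moreover have "inner (g v - g w) d = inner d d - inner (g w - g u) d"
    by (simp add: d_def flip: inner_diff_left)
  ultimately have "inner d d / 2 \<le> inner (g w - g u) d" by simp
  \<comment> \<open>Chaining the tangents at \<open>u\<close> and at \<open>w\<close> telescopes the
    function values.\<close>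
  moreover have "f u + inner (g u) (w - u) \<le> f w" "f w + inner (g w) (v - w) \<le> f v"
    by (rule gradient_inequality[OF f g])+
  then have "inner (g w - g u) (v - w) \<le> bregman f g v u"
    by (simp add: bregman_def inner_diff_left inner_diff_right)
  then have "inner (g w - g u) d / (2 * L) \<le> bregman f g v u" by (simp add: w_def)
  then have "inner (g w - g u) d \<le> 2 * L * bregman f g v u"
    using L(1) by (simp add: field_simps)
  ultimately show ?thesis by (simp add: d_def power2_norm_eq_inner)
qed

lemma bregman_nonneg:
  fixes f :: "'a::real_inner \<Rightarrow> real"
  assumes f: "convex_on UNIV f" and g: "\<And>u. GDERIV f u :> g u"
  shows "0 \<le> bregman f g v u"
  using gradient_inequality[OF f g, of u v] by (simp add: bregman_def)

section \<open>The trajectory\<close>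

lemma has_real_derivative_inner:
  assumes "(u has_vector_derivative u') (at t)" "(v has_vector_derivative v') (at t)"
  shows "((\<lambda>t. inner (u t) (v t)) has_real_derivative inner (u t) v' + inner u' (v t)) (at t)"
  using bounded_bilinear.has_vector_derivative[OF bounded_bilinear_inner assms]
  by (simp add: has_real_derivative_iff_has_vector_derivative)

lemma inner_add_scaleR_self:
  "inner (u + s *\<^sub>R v) (u + s *\<^sub>R v) = inner u u + 2 * s * inner u v + s\<^sup>2 * inner v v"
  by (simp add: inner_add_left inner_add_right inner_commute power2_eq_square)

lemma tendsto_one_over_at_top: "((\<lambda>t::real. 1 / t) \<longlongrightarrow> 0) at_top"
  using tendsto_inverse_0_at_top[OF filterlim_ident] by (simp add: inverse_eq_divide)

text \<open>
  \<open>P\<close> is an antiderivative of \<open>t \<beta>(t) \<epsilon>(t)\<close>, so its boundedness is the integrability hypothesis;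
  \<open>\<sigma>\<close> bounds \<open>t \<beta>'(t) / \<beta>(t)\<close>.
\<close>

locale primal_dual_flow =
  fixes f :: "'x::{real_inner,complete_space} \<Rightarrow> real"
    and g :: "'x \<Rightarrow> 'x"
    and A :: "'x \<Rightarrow> 'y::{real_inner,complete_space}"
    and b :: 'y
    and L T \<alpha> \<theta> \<rho> \<sigma> K :: real
    and \<beta> \<beta>' \<epsilon> \<epsilon>' P :: "real \<Rightarrow> real"
    and x x' x'' :: "real \<Rightarrow> 'x" and l l' l'' :: "real \<Rightarrow> 'y"
  assumes A: "bounded_linear A"
    and f_convex: "convex_on UNIV f"
    and f_grad: "\<And>u. GDERIV f u :> g u"
    and L: "L > 0" "lipschitz_on L UNIV g"
    and T: "T > 0"
    and \<epsilon>_nonneg: "\<And>t. t \<ge> T \<Longrightarrow> \<epsilon> t \<ge> 0"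
    and \<epsilon>'_nonpos: "\<And>t. t \<ge> T \<Longrightarrow> \<epsilon>' t \<le> 0"
    and \<epsilon>_deriv: "\<And>t. t \<ge> T \<Longrightarrow> (\<epsilon> has_real_derivative \<epsilon>' t) (at t)"
    and \<epsilon>_lim: "(\<epsilon> \<longlongrightarrow> 0) at_top"
    and \<beta>_pos: "\<And>t. t \<ge> T \<Longrightarrow> \<beta> t > 0"
    and \<beta>'_nonneg: "\<And>t. t \<ge> T \<Longrightarrow> \<beta>' t \<ge> 0"
    and \<beta>_deriv: "\<And>t. t \<ge> T \<Longrightarrow> (\<beta> has_real_derivative \<beta>' t) (at t)"
    and \<beta>_growth: "\<And>t. t \<ge> T \<Longrightarrow> t * \<beta>' t \<le> \<sigma> * \<beta> t"
    and \<sigma>: "\<theta> * \<sigma> < 1 - 2 * \<theta>"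
    and \<theta>: "\<theta> > 0" "\<theta> * (\<alpha> - 1) > 1"
    and \<rho>: "\<rho> > 0"
    and P_deriv: "\<And>t. t \<ge> T \<Longrightarrow> (P has_real_derivative t * \<beta> t * \<epsilon> t) (at t)"
    and P_le: "\<And>t. t \<ge> T \<Longrightarrow> P t \<le> K"
    and x_deriv: "\<And>t. t \<ge> T \<Longrightarrow> (x has_vector_derivative x' t) (at t)"
    and x'_deriv: "\<And>t. t \<ge> T \<Longrightarrow> (x' has_vector_derivative x'' t) (at t)"
    and l_deriv: "\<And>t. t \<ge> T \<Longrightarrow> (l has_vector_derivative l' t) (at t)"
    and l'_deriv: "\<And>t. t \<ge> T \<Longrightarrow> (l' has_vector_derivative l'' t) (at t)"
    and primal_eq: "\<And>t. t \<ge> T \<Longrightarrow> x'' t + (\<alpha> / t) *\<^sub>R x' t =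
             - (\<beta> t *\<^sub>R (g (x t) + adjoint A (l t + (\<theta> * t) *\<^sub>R l' t)
                         + \<rho> *\<^sub>R adjoint A (A (x t) - b) + \<epsilon> t *\<^sub>R x t))"
    and dual_eq: "\<And>t. t \<ge> T \<Longrightarrow> l'' t + (\<alpha> / t) *\<^sub>R l' t =
             \<beta> t *\<^sub>R (A (x t + (\<theta> * t) *\<^sub>R x' t) - b)"

text \<open>Fixes one KKT point, on which the energy depends; the trajectory and its data stay the
  same for all of them.\<close>

locale primal_dual_flow_solution = primal_dual_flow +
  fixes xs ls
  assumes KKT: "g xs + adjoint A ls = 0" "A xs = b"
begin

sublocale A: bounded_linear A by (rule A)

section \<open>Energy function and its ingredients\<close>

definition "\<xi> = \<theta> * (\<alpha> - 1) - 1"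
text \<open>Decay rate: the two entries of the minimum serve the kinetic part and the gap part of
  \<open>W\<close>. The second is positive by the strict bound on \<open>\<sigma>\<close>.\<close>

definition "\<kappa> = \<theta> * min (2 * \<xi>) (1 - 2 * \<theta> - \<theta> * \<sigma>)"
definition "c = \<theta> / 2 * inner xs xs"
text \<open>By the KKT equations the Bregman distance equals
  \<open>f (x t) - f xs + inner ls (A (x t) - b)\<close>, so this is the augmented Lagrangian gap at
  the multiplier \<open>ls\<close>.\<close>

definition "V t = bregman f g (x t) xs + \<rho> / 2 * inner (A (x t) - b) (A (x t) - b)"
definition "\<Phi> t = V t + \<epsilon> t / 2 * inner (x t) (x t)"
definition "W t = t * (inner (x' t) (x' t) + inner (l' t) (l' t)) / 2 + t * \<beta> t * \<Phi> t"
definition "v t = x t - xs + (\<theta> * t) *\<^sub>R x' t"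
definition "w t = l t - ls + (\<theta> * t) *\<^sub>R l' t"
definition "h t = (inner (x t - xs) (x t - xs) + inner (l t - ls) (l t - ls)) / 2"
definition "h' t = inner (x t - xs) (x' t) + inner (l t - ls) (l' t)"
definition "E t = (\<theta> * t)\<^sup>2 * \<beta> t * \<Phi> t + (inner (v t) (v t) + inner (w t) (w t)) / 2 + \<xi> * h t"

lemma pos: "\<xi> > 0" "\<kappa> > 0" "c \<ge> 0"
  using \<theta> \<sigma> by (auto simp: \<xi>_def \<kappa>_def c_def)

lemma adjoint: "inner u (adjoint A q) = inner (A u) q"
  using adjoint_hilbert[OF A, of u q] by simp

lemma gradient_at_solution: "inner (g xs) u = - inner ls (A u)"
proof -
  have "inner u (g xs + adjoint A ls) = 0" using KKT by simp
  then show ?thesis by (simp add: inner_add_right adjoint inner_commute)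
qed

lemma V_nonneg: "V t \<ge> 0"
  using bregman_nonneg[OF f_convex f_grad] \<rho> by (simp add: V_def)

lemma \<Phi>_nonneg: "t \<ge> T \<Longrightarrow> \<Phi> t \<ge> 0"
  using V_nonneg \<epsilon>_nonneg by (simp add: \<Phi>_def)

lemma W_nonneg: "t \<ge> T \<Longrightarrow> W t \<ge> 0"
  using \<Phi>_nonneg[of t] \<beta>_pos[of t] T by (simp add: W_def)

lemma E_bounds:
  assumes "t \<ge> T"
  shows "(\<theta> * t)\<^sup>2 * \<beta> t * \<Phi> t \<le> E t" "\<xi> * h t \<le> E t" "inner (v t) (v t) / 2 \<le> E t"
proof -
  have "0 \<le> (\<theta> * t)\<^sup>2 * \<beta> t * \<Phi> t" "0 \<le> \<xi> * h t"
    using \<Phi>_nonneg[OF assms] \<beta>_pos[OF assms] pos by (auto simp: h_def)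
  then show "(\<theta> * t)\<^sup>2 * \<beta> t * \<Phi> t \<le> E t" "\<xi> * h t \<le> E t" "inner (v t) (v t) / 2 \<le> E t"
    by (simp_all add: E_def add_increasing add_increasing2 add_divide_distrib)
qed

lemma E_nonneg: "t \<ge> T \<Longrightarrow> E t \<ge> 0"
  using \<Phi>_nonneg[of t] \<beta>_pos[of t] pos by (simp add: E_def h_def)

text \<open>Expanding the squares in \<open>v\<close> and \<open>w\<close> produces
  \<open>h'\<close> as cross term, which makes this a first-order equation for
  \<open>h\<close>.\<close>

lemma E_eq: "E t = (1 + \<xi>) * h t + \<theta> * t * h' t + \<theta>\<^sup>2 * t * W t"
  unfolding E_def h_def h'_def W_def v_def w_def inner_add_scaleR_self
  by (simp add: field_simps power2_eq_square)

section \<open>Derivatives along the trajectory\<close>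

lemma x_minus_xs_deriv: "t \<ge> T \<Longrightarrow> ((\<lambda>t. x t - xs) has_vector_derivative x' t) (at t)"
  using x_deriv by (auto intro!: derivative_eq_intros)

lemma l_minus_ls_deriv: "t \<ge> T \<Longrightarrow> ((\<lambda>t. l t - ls) has_vector_derivative l' t) (at t)"
  using l_deriv by (auto intro!: derivative_eq_intros)

lemma residual_deriv: "t \<ge> T \<Longrightarrow> ((\<lambda>t. A (x t) - b) has_vector_derivative A (x' t)) (at t)"
  using A.has_vector_derivative[OF x_deriv] by (auto intro!: derivative_eq_intros)

lemma h_deriv:
  assumes t: "t \<ge> T"
  shows "(h has_real_derivative h' t) (at t)"
  unfolding h_def h'_def
  by (rule DERIV_cong[OF DERIV_cdivide[OF DERIV_add[OF
        has_real_derivative_inner[OF x_minus_xs_deriv[OF t] x_minus_xs_deriv[OF t]]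
        has_real_derivative_inner[OF l_minus_ls_deriv[OF t] l_minus_ls_deriv[OF t]]]]])
    (simp add: inner_commute)

lemma f_x_deriv:
  assumes t: "t \<ge> T"
  shows "((\<lambda>t. f (x t)) has_real_derivative inner (g (x t)) (x' t)) (at t)"
proof -
  have "(f has_derivative (\<lambda>h. inner h (g (x t)))) (at (x t))"
    using f_grad[of "x t"] by (simp add: gderiv_def)
  with x_deriv[OF t] have "((\<lambda>t. f (x t)) has_derivative (\<lambda>s. inner (s *\<^sub>R x' t) (g (x t)))) (at t)"
    unfolding has_vector_derivative_def using has_derivative_compose by blast
  then show ?thesis
    by (simp add: has_field_derivative_def mult_commute_abs inner_commute)
qed

lemma \<Phi>_deriv:
  assumes t: "t \<ge> T"
  shows "(\<Phi> has_real_derivative inner (g (x t) - g xs) (x' t) + \<rho> * inner (A (x t) - b) (A (x' t))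
     + \<epsilon>' t / 2 * inner (x t) (x t) + \<epsilon> t * inner (x t) (x' t)) (at t)"
proof -
  have 1: "((\<lambda>t. inner (g xs) (x t - xs)) has_real_derivative inner (g xs) (x' t)) (at t)"
    using has_real_derivative_inner[OF has_vector_derivative_const x_minus_xs_deriv[OF t]] by simp
  show ?thesis unfolding \<Phi>_def V_def bregman_def
    by (rule DERIV_cong[OF DERIV_add[OF DERIV_add[OF
            DERIV_diff[OF DERIV_diff[OF f_x_deriv[OF t] DERIV_const] 1]
            DERIV_cmult[OF has_real_derivative_inner[OF residual_deriv[OF t] residual_deriv[OF t]]]]
          DERIV_mult[OF DERIV_cdivide[OF \<epsilon>_deriv[OF t]]
            has_real_derivative_inner[OF x_deriv[OF t] x_deriv[OF t]]]]])
      (simp add: inner_commute inner_diff_left inner_diff_right)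
qed

text \<open>The product rule gives \<open>(1 + \<theta>) x' + \<theta> t x''\<close>; the friction
  term turns the first coefficient into \<open>- \<xi>\<close>, and the KKT equation recentres
  gradient and multiplier.\<close>

lemma v_deriv:
  assumes t: "t \<ge> T"
  shows "(v has_vector_derivative - \<xi> *\<^sub>R x' t - (\<theta> * t * \<beta> t) *\<^sub>R
    (g (x t) - g xs + adjoint A (w t) + \<rho> *\<^sub>R adjoint A (A (x t) - b) + \<epsilon> t *\<^sub>R x t)) (at t)"
    (is "(v has_vector_derivative ?v') (at t)")
proof -
  \<comment> \<open>The adjoint is accessed through inner products, so the difference of both sides
    is tested against every \<open>u\<close>, finally against itself.\<close>
  have adj: "adjoint A (l t + (\<theta> * t) *\<^sub>R l' t) = - g xs + adjoint A (w t)"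
  proof -
    have "inner u (adjoint A (l t + (\<theta> * t) *\<^sub>R l' t) - (- g xs + adjoint A (w t))) = 0" for u
      using gradient_at_solution[of u]
      by (simp add: inner_diff_right inner_add_right adjoint w_def inner_commute[of u "g xs"]
          inner_commute[of "A u" ls])
    from this[of "adjoint A (l t + (\<theta> * t) *\<^sub>R l' t) - (- g xs + adjoint A (w t))"]
    show ?thesis by simp
  qed
  define G where "G = g (x t) - g xs + adjoint A (w t) + \<rho> *\<^sub>R adjoint A (A (x t) - b) + \<epsilon> t *\<^sub>R x t"
  have "x'' t + (\<alpha> / t) *\<^sub>R x' t = - (\<beta> t *\<^sub>R G)"
    using primal_eq[OF t] by (simp add: adj G_def algebra_simps)
  then have x'': "x'' t = - (\<beta> t *\<^sub>R G) - (\<alpha> / t) *\<^sub>R x' t" by (metis add_diff_cancel_right')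
  have "t \<noteq> 0" using t T by simp
  then have "?v' = (1 + \<theta>) *\<^sub>R x' t + (\<theta> * t) *\<^sub>R x'' t"
    unfolding G_def[symmetric] x'' by (simp add: \<xi>_def algebra_simps)
  moreover have "(v has_vector_derivative (1 + \<theta>) *\<^sub>R x' t + (\<theta> * t) *\<^sub>R x'' t) (at t)"
    unfolding v_def using x_deriv[OF t] x'_deriv[OF t]
    by (auto intro!: derivative_eq_intros simp: algebra_simps)
  ultimately show ?thesis by simp
qed

lemma w_deriv:
  assumes t: "t \<ge> T"
  shows "(w has_vector_derivative - \<xi> *\<^sub>R l' t + (\<theta> * t * \<beta> t) *\<^sub>R
    (A (x t) - b + (\<theta> * t) *\<^sub>R A (x' t))) (at t)" (is "(w has_vector_derivative ?w') (at t)")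
proof -
  define R where "R = A (x t) - b + (\<theta> * t) *\<^sub>R A (x' t)"
  have "l'' t + (\<alpha> / t) *\<^sub>R l' t = \<beta> t *\<^sub>R R"
    using dual_eq[OF t] by (simp add: A.add A.scaleR R_def algebra_simps)
  then have l'': "l'' t = \<beta> t *\<^sub>R R - (\<alpha> / t) *\<^sub>R l' t" by (metis add_diff_cancel_right')
  have "t \<noteq> 0" using t T by simp
  then have "?w' = (1 + \<theta>) *\<^sub>R l' t + (\<theta> * t) *\<^sub>R l'' t"
    unfolding R_def[symmetric] l'' by (simp add: \<xi>_def algebra_simps)
  moreover have "(w has_vector_derivative (1 + \<theta>) *\<^sub>R l' t + (\<theta> * t) *\<^sub>R l'' t) (at t)"
    unfolding w_def using l_deriv[OF t] l'_deriv[OF t]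
    by (auto intro!: derivative_eq_intros simp: algebra_simps)
  ultimately show ?thesis by simp
qed

section \<open>Dissipation of the energy\<close>

definition "E' t = \<theta> * t * (2 * \<theta> * \<beta> t + \<theta> * t * \<beta>' t) * \<Phi> t
  + (\<theta> * t)\<^sup>2 * \<beta> t * \<epsilon>' t / 2 * inner (x t) (x t)
  - \<xi> * \<theta> * t * (inner (x' t) (x' t) + inner (l' t) (l' t))
  - \<theta> * t * \<beta> t * (inner (g (x t) - g xs) (x t - xs) + \<rho> * inner (A (x t) - b) (A (x t) - b)
      + \<epsilon> t * inner (x t) (x t - xs))"

text \<open>The extrapolation in the system makes cross terms cancel: products with
  \<open>w t\<close> between the \<open>v\<close> and \<open>w\<close> parts, products with
  \<open>x' t\<close> against the derivative of \<open>\<Phi>\<close>, and \<open>\<xi> * h'\<close>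
  against the friction terms.\<close>

lemma E_deriv:
  assumes t: "t \<ge> T"
  shows "(E has_real_derivative E' t) (at t)"
proof -
  define G where "G = g (x t) - g xs + adjoint A (w t) + \<rho> *\<^sub>R adjoint A (A (x t) - b) + \<epsilon> t *\<^sub>R x t"
  define R where "R = A (x t) - b"
  have v: "(v has_vector_derivative - \<xi> *\<^sub>R x' t - (\<theta> * t * \<beta> t) *\<^sub>R G) (at t)"
    using v_deriv[OF t] by (simp add: G_def)
  have w: "(w has_vector_derivative - \<xi> *\<^sub>R l' t + (\<theta> * t * \<beta> t) *\<^sub>R (R + (\<theta> * t) *\<^sub>R A (x' t))) (at t)"
    using w_deriv[OF t] by (simp add: R_def)
  have R: "A (x t - xs) = R" by (simp add: A.diff KKT R_def)
  have Gd: "inner (x t - xs) G = inner (g (x t) - g xs) (x t - xs) + inner R (w t)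
      + \<rho> * inner R R + \<epsilon> t * inner (x t) (x t - xs)"
    unfolding G_def inner_add_right inner_scaleR_right adjoint R
    by (simp add: R_def inner_commute)
  have Gx': "inner (x' t) G = inner (g (x t) - g xs) (x' t) + inner (A (x' t)) (w t)
      + \<rho> * inner R (A (x' t)) + \<epsilon> t * inner (x t) (x' t)"
    unfolding G_def inner_add_right inner_scaleR_right adjoint
    by (simp add: R_def inner_commute)
  have vv: "((\<lambda>t. inner (v t) (v t)) has_real_derivative
      2 * (- \<xi> * (inner (x t - xs) (x' t) + \<theta> * t * inner (x' t) (x' t))
        - \<theta> * t * \<beta> t * (inner (x t - xs) G + \<theta> * t * inner (x' t) G))) (at t)"
    using has_real_derivative_inner[OF v v]
    by (rule DERIV_cong)
      (simp add: v_def inner_add_left inner_add_right inner_diff_left inner_diff_right inner_commute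
        algebra_simps)
  have ww: "((\<lambda>t. inner (w t) (w t)) has_real_derivative
      2 * (- \<xi> * (inner (l t - ls) (l' t) + \<theta> * t * inner (l' t) (l' t))
        + \<theta> * t * \<beta> t * (inner R (w t) + \<theta> * t * inner (A (x' t)) (w t)))) (at t)"
    using has_real_derivative_inner[OF w w]
    by (rule DERIV_cong)
      (simp add: w_def inner_add_left inner_add_right inner_diff_left inner_diff_right inner_commute
        algebra_simps)
  have weight: "((\<lambda>t. (\<theta> * t)\<^sup>2 * \<beta> t) has_real_derivative
      \<theta> * t * (2 * \<theta> * \<beta> t + \<theta> * t * \<beta>' t)) (at t)"
    using \<beta>_deriv[OF t]
    by (auto intro!: derivative_eq_intros simp: algebra_simps power2_eq_square)
  have half: "(2 * a + 2 * b) / 2 = a + b" for a b :: real by simp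
  note E_parts = DERIV_add[OF DERIV_add[OF DERIV_mult[OF weight \<Phi>_deriv[OF t]]
        DERIV_cong[OF DERIV_cdivide[OF DERIV_add[OF vv ww]] half]] DERIV_cmult[OF h_deriv[OF t]]]
  show ?thesis
    unfolding E_def
    by (rule DERIV_cong[OF E_parts], unfold Gd Gx' E'_def h'_def R_def[symmetric])
      (simp add: algebra_simps power2_eq_square)
qed

text \<open>Convexity bounds the last bracket of \<open>E'\<close> below by \<open>\<Phi>\<close>
  minus a Tikhonov error. Its weight beats the growth of
  \<open>(\<theta> * t)\<^sup>2 * \<beta> t\<close>, which leaves a positive multiple of
  \<open>W\<close>.\<close>

lemma E'_le:
  assumes t: "t \<ge> T"
  shows "E' t \<le> c * (t * \<beta> t * \<epsilon> t) - \<kappa> * W t"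
proof -
  have t0: "t > 0" using t T by simp
  note nonneg = \<beta>_pos[OF t] \<epsilon>_nonneg[OF t] \<Phi>_nonneg[OF t]
  define q where "q = inner (x' t) (x' t) + inner (l' t) (l' t)"
  have q: "q \<ge> 0" by (simp add: q_def)
  \<comment> \<open>The slack is the Bregman distance with swapped arguments.\<close>
  have "bregman f g (x t) xs \<le> inner (g (x t) - g xs) (x t - xs)"
    using bregman_nonneg[OF f_convex f_grad, of xs "x t"]
    by (simp add: bregman_def inner_diff_left inner_diff_right)
  moreover have "\<rho> / 2 * inner (A (x t) - b) (A (x t) - b) \<le> \<rho> * inner (A (x t) - b) (A (x t) - b)"
    using \<rho> by (intro mult_right_mono) auto
  \<comment> \<open>The defect \<open>\<epsilon> t / 2 * inner xs xs\<close> is the origin of the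
    error constant \<open>c\<close>.\<close>
  moreover have "\<epsilon> t * ((inner (x t) (x t) - inner xs xs) / 2) \<le> \<epsilon> t * inner (x t) (x t - xs)"
  proof (rule mult_left_mono)
    have "0 \<le> inner (x t - xs) (x t - xs)" by simp
    then show "(inner (x t) (x t) - inner xs xs) / 2 \<le> inner (x t) (x t - xs)"
      by (simp add: inner_diff_left inner_diff_right inner_commute)
  qed (use nonneg in simp)
  ultimately have "\<Phi> t - \<epsilon> t / 2 * inner xs xs \<le> inner (g (x t) - g xs) (x t - xs)
      + \<rho> * inner (A (x t) - b) (A (x t) - b) + \<epsilon> t * inner (x t) (x t - xs)" (is "_ \<le> ?M")
    unfolding \<Phi>_def V_def by (simp add: algebra_simps diff_divide_distrib)
  then have 1: "\<theta> * t * \<beta> t * (\<Phi> t - \<epsilon> t / 2 * inner xs xs) \<le> \<theta> * t * \<beta> t * ?M"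
    using nonneg t0 \<theta> by (intro mult_left_mono) auto
  have 2: "(\<theta> * t)\<^sup>2 * \<beta> t * \<epsilon>' t / 2 * inner (x t) (x t) \<le> 0"
    using nonneg \<epsilon>'_nonpos[OF t] by (simp add: mult_nonneg_nonpos mult_nonpos_nonneg)
  have "\<theta> * (t * \<beta>' t) \<le> \<theta> * (\<sigma> * \<beta> t)" using \<beta>_growth[OF t] \<theta> by (intro mult_left_mono) auto
  then have "2 * \<theta> * \<beta> t + \<theta> * t * \<beta>' t \<le> (2 * \<theta> + \<theta> * \<sigma>) * \<beta> t" by (simp add: algebra_simps)
  then have 3: "\<theta> * t * (2 * \<theta> * \<beta> t + \<theta> * t * \<beta>' t) * \<Phi> t
      \<le> \<theta> * t * ((2 * \<theta> + \<theta> * \<sigma>) * \<beta> t) * \<Phi> t"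
    using nonneg t0 \<theta> by (intro mult_left_mono mult_right_mono) auto
  have "\<kappa> * (t * q / 2) \<le> (\<theta> * (2 * \<xi>)) * (t * q / 2)"
    using t0 q \<theta> unfolding \<kappa>_def by (intro mult_right_mono mult_left_mono) auto
  moreover have "\<kappa> * (t * \<beta> t * \<Phi> t) \<le> (\<theta> * (1 - 2 * \<theta> - \<theta> * \<sigma>)) * (t * \<beta> t * \<Phi> t)"
    using t0 nonneg \<theta> unfolding \<kappa>_def by (intro mult_right_mono mult_left_mono) auto
  ultimately have "\<kappa> * W t \<le> \<xi> * \<theta> * t * q + \<theta> * (1 - 2 * \<theta> - \<theta> * \<sigma>) * (t * \<beta> t * \<Phi> t)"
    unfolding W_def q_def[symmetric] by (simp add: algebra_simps)
  with 1 2 3 show ?thesis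
    unfolding E'_def q_def[symmetric] c_def by (simp add: algebra_simps)
qed

section \<open>Limits of the energy and of the distance\<close>

lemma P_tendsto: "\<exists>m. (P \<longlongrightarrow> m) at_top"
proof (rule bounded_nondecreasing_tendsto[OF P_deriv _ P_le])
  show "0 \<le> t * \<beta> t * \<epsilon> t" if "t \<ge> T" for t
    using that T \<beta>_pos[of t] \<epsilon>_nonneg[of t] by simp
qed

text \<open>\<open>c * P - E\<close> is nondecreasing by the dissipation estimate and at most
  \<open>c * K\<close> because \<open>E\<close> is nonnegative. As \<open>P\<close> converges, so
  does \<open>E\<close>.\<close>

lemma E_tendsto: "\<exists>m. (E \<longlongrightarrow> m) at_top"
proof -
  have "\<exists>m. ((\<lambda>t. c * P t - E t) \<longlongrightarrow> m) at_top"
  proof (rule bounded_nondecreasing_tendsto[of T])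
    fix t assume t: "t \<ge> T"
    show "((\<lambda>t. c * P t - E t) has_real_derivative c * (t * \<beta> t * \<epsilon> t) - E' t) (at t)"
      using P_deriv[OF t] E_deriv[OF t] by (auto intro!: derivative_eq_intros)
    have "0 \<le> \<kappa> * W t" using pos W_nonneg[OF t] by simp
    then show "0 \<le> c * (t * \<beta> t * \<epsilon> t) - E' t" using E'_le[OF t] by linarith
    show "c * P t - E t \<le> c * K"
      using E_nonneg[OF t] mult_left_mono[OF P_le[OF t] pos(3)] by linarith
  qed
  then obtain m where m: "((\<lambda>t. c * P t - E t) \<longlongrightarrow> m) at_top" by blast
  obtain p where p: "(P \<longlongrightarrow> p) at_top" using P_tendsto by blast
  have "((\<lambda>t. c * P t - (c * P t - E t)) \<longlongrightarrow> c * p - m) at_top"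
    by (intro tendsto_intros m p)
  then show ?thesis by auto
qed

lemma continuous_W: "continuous_on {T..} W"
proof -
  have "continuous_on {T..} x" "continuous_on {T..} x'" "continuous_on {T..} l'"
    using x_deriv x'_deriv l'_deriv
    by (auto intro!: continuous_at_imp_continuous_on has_vector_derivative_continuous)
  moreover have "continuous_on {T..} \<beta>" "continuous_on {T..} \<Phi>"
    using \<beta>_deriv \<Phi>_deriv by (auto intro!: continuous_at_imp_continuous_on DERIV_isCont)
  ultimately show ?thesis unfolding W_def by (intro continuous_intros) auto
qed

text \<open>The same estimate with the term \<open>\<kappa> * W\<close> retained: \<open>F\<close>
  is nonincreasing, which bounds \<open>Q\<close> from above.\<close>

lemma integral_W_tendsto:
  obtains Q m where "\<And>t. t > T \<Longrightarrow> (Q has_real_derivative W t) (at t)" "(Q \<longlongrightarrow> m) at_top"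
proof -
  obtain Q where Q: "\<And>t. t > T \<Longrightarrow> (Q has_real_derivative W t) (at t)"
    using antiderivative_at_top[OF continuous_W] by blast
  define S where "S = T + 1"
  define F where "F t = \<kappa> * Q t + E t - c * P t" for t
  have "\<exists>m. (Q \<longlongrightarrow> m) at_top"
  proof (rule bounded_nondecreasing_tendsto[of S])
    fix t assume t: "t \<ge> S"
    show "(Q has_real_derivative W t) (at t)" "W t \<ge> 0"
      using t Q W_nonneg by (auto simp: S_def)
    have "F t \<le> F S"
    proof (rule DERIV_nonpos_imp_nonincreasing[OF t])
      fix s assume s: "S \<le> s" "s \<le> t"
      then have s': "s > T" by (simp add: S_def)
      have "(F has_real_derivative \<kappa> * W s + E' s - c * (s * \<beta> s * \<epsilon> s)) (at s)"
        unfolding F_def using Q[OF s'] P_deriv[of s] E_deriv[of s] s'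
        by (auto intro!: derivative_eq_intros)
      then show "\<exists>y. (F has_real_derivative y) (at s) \<and> y \<le> 0"
        using E'_le[of s] s' by (intro exI conjI) auto
    qed
    moreover have "c * P t \<le> c * K" using t by (intro mult_left_mono P_le pos) (simp add: S_def)
    moreover have "E t \<ge> 0" using t by (intro E_nonneg) (simp add: S_def)
    ultimately have "\<kappa> * Q t \<le> F S + c * K" by (simp add: F_def)
    then show "Q t \<le> (F S + c * K) / \<kappa>" using pos by (simp add: field_simps)
  qed
  with Q that show thesis by blast
qed

text \<open>
  The distance satisfies \<open>\<theta> t h' + (1 + \<xi>) h = E - \<theta>\<^sup>2 t W\<close>, where \<open>t W\<close> is not known to converge.
  Since \<open>W\<close> is integrable, adding its antiderivative to \<open>h\<close> absorbs that term.
\<close>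

lemma h_tendsto: "\<exists>m. (h \<longlongrightarrow> m) at_top"
proof -
  obtain Q q where Q: "\<And>t. t > T \<Longrightarrow> (Q has_real_derivative W t) (at t)" "(Q \<longlongrightarrow> q) at_top"
    using integral_W_tendsto by blast
  obtain e where e: "(E \<longlongrightarrow> e) at_top" using E_tendsto by blast
  have "((\<lambda>t. h t + \<theta> * Q t) \<longlongrightarrow> (e + (1 + \<xi>) * \<theta> * q) / (1 + \<xi>)) at_top"
  proof (rule ODE_tendsto[where T = "T + 1" and \<theta> = \<theta>])
    show "((\<lambda>t. h t + \<theta> * Q t) has_real_derivative h' t + \<theta> * W t) (at t)" if "t \<ge> T + 1" for t
      using that h_deriv[of t] Q(1)[of t] by (auto intro!: derivative_eq_intros)
    have "\<theta> * t * (h' t + \<theta> * W t) + (1 + \<xi>) * (h t + \<theta> * Q t) = E t + (1 + \<xi>) * \<theta> * Q t" for t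
      unfolding E_eq by (simp add: algebra_simps power2_eq_square)
    then show "((\<lambda>t. \<theta> * t * (h' t + \<theta> * W t) + (1 + \<xi>) * (h t + \<theta> * Q t))
        \<longlongrightarrow> e + (1 + \<xi>) * \<theta> * q) at_top"
      by (simp only:) (intro tendsto_intros e Q(2))
  qed (use pos \<theta> in auto)
  from tendsto_diff[OF this tendsto_mult[OF tendsto_const[of \<theta>] Q(2)]] show ?thesis by auto
qed

section \<open>Strong convergence of gap, residual and gradient\<close>

lemma \<beta>_ge: "t \<ge> T \<Longrightarrow> \<beta> t \<ge> \<beta> T"
  by (rule DERIV_nonneg_imp_nondecreasing[of T t \<beta>])
    (auto intro!: exI[of _ "\<beta>' _"] \<beta>_deriv \<beta>'_nonneg)

lemma E_bounded: obtains C where "C > 0" "\<forall>\<^sub>F t in at_top. E t \<le> C"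
proof -
  obtain e where e: "(E \<longlongrightarrow> e) at_top" using E_tendsto by blast
  have "\<forall>\<^sub>F t in at_top. E t < \<bar>e\<bar> + 1" by (rule order_tendstoD(2)[OF e]) auto
  then have "\<forall>\<^sub>F t in at_top. E t \<le> \<bar>e\<bar> + 1" by eventually_elim simp
  then show thesis by (intro that[of "\<bar>e\<bar> + 1"]) auto
qed

text \<open>The bounded \<open>E\<close> dominates
  \<open>(\<theta> * t)\<^sup>2 * \<beta> t * V t\<close>, and \<open>\<beta>\<close> stays above
  \<open>\<beta> T\<close>, so the gap is of order \<open>1 / t\<^sup>2\<close>.\<close>

lemma V_tendsto: "(V \<longlongrightarrow> 0) at_top"
proof -
  obtain C where C: "C > 0" "\<forall>\<^sub>F t in at_top. E t \<le> C" using E_bounded .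
  have "\<forall>\<^sub>F t in at_top. V t \<le> C / (\<theta>\<^sup>2 * \<beta> T) * (1 / t * (1 / t))"
    using C(2) eventually_ge_at_top[of T]
  proof eventually_elim
    case (elim t)
    have "(\<theta> * t)\<^sup>2 * \<beta> T * V t \<le> (\<theta> * t)\<^sup>2 * \<beta> t * \<Phi> t"
      using \<beta>_ge[of t] V_nonneg[of t] \<beta>_pos[of t] \<epsilon>_nonneg[of t] elim
      by (intro mult_mono mult_left_mono) (auto simp: \<Phi>_def)
    also have "\<dots> \<le> E t" using elim by (intro E_bounds)
    also have "\<dots> \<le> C" using elim by blast
    finally have "(\<theta> * t)\<^sup>2 * \<beta> T * V t \<le> C" .
    moreover have "(\<theta> * t)\<^sup>2 * \<beta> T > 0" using T elim \<beta>_pos[of T] \<theta> by simp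
    ultimately have "V t \<le> C / ((\<theta> * t)\<^sup>2 * \<beta> T)" by (simp add: pos_le_divide_eq mult.commute)
    also have "\<dots> = C / (\<theta>\<^sup>2 * \<beta> T) * (1 / t * (1 / t))" by (simp add: power2_eq_square)
    finally show ?case .
  qed
  moreover have "((\<lambda>t. C / (\<theta>\<^sup>2 * \<beta> T) * (1 / t * (1 / t))) \<longlongrightarrow> C / (\<theta>\<^sup>2 * \<beta> T) * (0 * 0)) at_top"
    by (rule tendsto_mult[OF tendsto_const tendsto_mult[OF tendsto_one_over_at_top tendsto_one_over_at_top]])
  ultimately show ?thesis
    using tendsto_sandwich[OF always_eventually _ tendsto_const[of 0]] V_nonneg by force
qed

lemma bregman_tendsto: "((\<lambda>t. bregman f g (x t) xs) \<longlongrightarrow> 0) at_top"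
  by (rule tendsto_sandwich[OF _ _ tendsto_const V_tendsto])
    (use \<rho> bregman_nonneg[OF f_convex f_grad] in \<open>auto simp: V_def\<close>)

lemma residual_tendsto: "((\<lambda>t. A (x t) - b) \<longlongrightarrow> 0) at_top"
proof -
  have "((\<lambda>t. (norm (A (x t) - b))\<^sup>2) \<longlongrightarrow> 0) at_top"
  proof (rule tendsto_sandwich[OF _ _ tendsto_const])
    show "((\<lambda>t. 2 / \<rho> * V t) \<longlongrightarrow> 0) at_top"
      using tendsto_mult[OF tendsto_const[of "2 / \<rho>"] V_tendsto] by simp
    have "(norm (A (x t) - b))\<^sup>2 \<le> 2 / \<rho> * V t" for t
    proof -
      have "\<rho> / 2 * (norm (A (x t) - b))\<^sup>2 \<le> V t"
        using bregman_nonneg[OF f_convex f_grad] by (simp add: V_def power2_norm_eq_inner)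
      then have "2 / \<rho> * (\<rho> / 2 * (norm (A (x t) - b))\<^sup>2) \<le> 2 / \<rho> * V t"
        using \<rho> by (intro mult_left_mono) auto
      then show ?thesis using \<rho> by simp
    qed
    then show "\<forall>\<^sub>F t in at_top. (norm (A (x t) - b))\<^sup>2 \<le> 2 / \<rho> * V t" by simp
  qed simp
  from tendsto_real_sqrt[OF this] show ?thesis by (simp add: tendsto_norm_zero_iff)
qed

lemma gradient_tendsto: "((\<lambda>t. g (x t) - g xs) \<longlongrightarrow> 0) at_top"
proof -
  have "((\<lambda>t. (norm (g (x t) - g xs))\<^sup>2) \<longlongrightarrow> 0) at_top"
  proof (rule tendsto_sandwich[OF _ _ tendsto_const])
    show "((\<lambda>t. 4 * L * bregman f g (x t) xs) \<longlongrightarrow> 0) at_top"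
      using tendsto_mult[OF tendsto_const bregman_tendsto] by simp
    show "\<forall>\<^sub>F t in at_top. (norm (g (x t) - g xs))\<^sup>2 \<le> 4 * L * bregman f g (x t) xs"
      using bregman_bound_gradient[OF f_convex f_grad L] by simp
  qed simp
  from tendsto_real_sqrt[OF this] show ?thesis by (simp add: tendsto_norm_zero_iff)
qed

section \<open>Bounds on the trajectory and the limit of the multiplier\<close>

text \<open>\<open>E\<close> dominates \<open>\<xi> * h\<close> and half the square of
  \<open>v\<close>; since \<open>v - (x - xs)\<close> is \<open>\<theta> t x'\<close>, the velocity
  is of order \<open>1 / t\<close>.\<close>

lemma trajectory_bounded:
  obtains M where "\<forall>\<^sub>F t in at_top. norm (x t) \<le> M" "\<forall>\<^sub>F t in at_top. norm (x' t) \<le> M / t"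
proof -
  obtain C where C: "C > 0" "\<forall>\<^sub>F t in at_top. E t \<le> C" using E_bounded .
  define M0 where "M0 = sqrt (2 * C / \<xi>)"
  define M1 where "M1 = sqrt (2 * C)"
  define M where "M = max (M0 + norm xs) ((M0 + M1) / \<theta>)"
  have ev: "\<forall>\<^sub>F t in at_top. norm (x t - xs) \<le> M0 \<and> norm (v t) \<le> M1 \<and> t > 0"
    using C(2) eventually_ge_at_top[of T]
  proof eventually_elim
    case (elim t)
    have "\<xi> * (inner (x t - xs) (x t - xs) / 2) \<le> \<xi> * h t"
      using pos by (intro mult_left_mono) (auto simp: h_def)
    then have "\<xi> * (inner (x t - xs) (x t - xs) / 2) \<le> C"
      using E_bounds(2)[of t] elim by linarith
    then have "(norm (x t - xs))\<^sup>2 \<le> 2 * C / \<xi>"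
      using pos by (simp add: power2_norm_eq_inner field_simps)
    then have 1: "norm (x t - xs) \<le> M0" unfolding M0_def by (rule real_le_rsqrt)
    have "inner (v t) (v t) \<le> 2 * C" using E_bounds(3)[of t] elim by linarith
    then have "(norm (v t))\<^sup>2 \<le> 2 * C" by (simp add: power2_norm_eq_inner)
    then have "norm (v t) \<le> M1" unfolding M1_def by (rule real_le_rsqrt)
    with 1 elim T show ?case by auto
  qed
  show thesis
  proof (rule that[of M])
    show "\<forall>\<^sub>F t in at_top. norm (x t) \<le> M"
      using ev
    proof eventually_elim
      case (elim t)
      then show ?case using norm_triangle_ineq[of "x t - xs" xs] by (auto simp: M_def)
    qed
    show "\<forall>\<^sub>F t in at_top. norm (x' t) \<le> M / t"
      using ev
    proof eventually_elim
      case (elim t)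
      have "(\<theta> * t) *\<^sub>R x' t = v t - (x t - xs)" by (simp add: v_def)
      then have "\<theta> * t * norm (x' t) = norm (v t - (x t - xs))"
        using \<theta> elim by (metis abs_of_pos mult_pos_pos norm_scaleR)
      then have "\<theta> * t * norm (x' t) \<le> M0 + M1"
        using norm_triangle_ineq4[of "v t" "x t - xs"] elim by linarith
      then have "t * norm (x' t) \<le> (M0 + M1) / \<theta>" using \<theta> by (simp add: field_simps)
      then have "t * norm (x' t) \<le> M" by (simp add: M_def)
      then show ?case using elim by (simp add: field_simps)
    qed
  qed
qed

text \<open>
  The primal equation expresses \<open>q + \<theta> t q'\<close> for \<open>q = adjoint A (l - ls)\<close> through \<open>x'' / \<beta>\<close> and
  vanishing terms. Absorbing \<open>x'' / \<beta>\<close> by adding \<open>x' / (\<theta> t \<beta>)\<close> to \<open>q\<close> gives an equation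
  whose right-hand side tends to zero.
\<close>

lemma multiplier_tendsto: "((\<lambda>t. inner (l t) (A y)) \<longlongrightarrow> inner ls (A y)) at_top"
proof -
  obtain M where M: "\<forall>\<^sub>F t in at_top. norm (x t) \<le> M" "\<forall>\<^sub>F t in at_top. norm (x' t) \<le> M / t"
    using trajectory_bounded .
  define q where "q t = inner (l t - ls) (A y)" for t
  define z where "z t = inner (x' t) y / (t * \<beta> t)" for t
  \<comment> \<open>\<open>\<gamma> t / t\<close> is the logarithmic derivative of
    \<open>t * \<beta> t\<close>, which appears on differentiating \<open>z\<close>; the growth
    bound on \<open>\<beta>\<close> keeps \<open>\<gamma>\<close> bounded.\<close>
  define \<gamma> where "\<gamma> t = 1 + t * \<beta>' t / \<beta> t" for t
  \<comment> \<open>The value of \<open>\<theta> t u' + u\<close> for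
    \<open>u = q + z / \<theta>\<close>. In the factor of \<open>z\<close>,
    \<open>1 / \<theta>\<close> comes from \<open>u\<close>, \<open>\<alpha>\<close> from friction
    and \<open>\<gamma>\<close> from the derivative of \<open>z\<close>.\<close>
  define rhs where "rhs t = - inner (g (x t) - g xs) y - \<rho> * inner (A (x t) - b) (A y)
    - \<epsilon> t * inner (x t) y + (1 / \<theta> - \<alpha> - \<gamma> t) * z t" for t
  have z: "(z \<longlongrightarrow> 0) at_top"
  proof (rule Lim_null_comparison)
    show "\<forall>\<^sub>F t in at_top. norm (z t) \<le> \<bar>M\<bar> * norm y / \<beta> T * (1 / t * (1 / t))"
      using M(2) eventually_ge_at_top[of T]
    proof eventually_elim
      case (elim t)
      have t: "t > 0" using elim T by simp
      have "M / t \<le> \<bar>M\<bar> / t" using t by (intro divide_right_mono) auto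
      then have "\<bar>inner (x' t) y\<bar> \<le> \<bar>M\<bar> / t * norm y"
        using Cauchy_Schwarz_ineq2[of "x' t" y] mult_right_mono[of "norm (x' t)" "\<bar>M\<bar> / t" "norm y"]
          elim by simp
      then have "\<bar>inner (x' t) y\<bar> / (t * \<beta> t) \<le> (\<bar>M\<bar> / t * norm y) / (t * \<beta> T)"
        using t \<beta>_ge[of t] \<beta>_pos[of T] \<beta>_pos[of t] elim by (intro frac_le) auto
      then show ?case
        using t \<beta>_pos[of t] elim by (simp add: z_def abs_mult field_simps)
    qed
    have "((\<lambda>t. \<bar>M\<bar> * norm y / \<beta> T * (1 / t * (1 / t))) \<longlongrightarrow> \<bar>M\<bar> * norm y / \<beta> T * (0 * 0)) at_top"
      by (rule tendsto_mult[OF tendsto_const tendsto_mult[OF tendsto_one_over_at_top tendsto_one_over_at_top]])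
    then show "((\<lambda>t. \<bar>M\<bar> * norm y / \<beta> T * (1 / t * (1 / t))) \<longlongrightarrow> 0) at_top" by simp
  qed
  have \<gamma>z: "((\<lambda>t. (1 / \<theta> - \<alpha> - \<gamma> t) * z t) \<longlongrightarrow> 0) at_top"
  proof (rule Lim_null_comparison)
    show "\<forall>\<^sub>F t in at_top. norm ((1 / \<theta> - \<alpha> - \<gamma> t) * z t) \<le> (\<bar>1 / \<theta> - \<alpha>\<bar> + (1 + \<sigma>)) * \<bar>z t\<bar>"
      using eventually_ge_at_top[of T]
    proof eventually_elim
      case (elim t)
      have "0 \<le> t * \<beta>' t / \<beta> t" "t * \<beta>' t / \<beta> t \<le> \<sigma>"
        using \<beta>_growth[of t] \<beta>'_nonneg[of t] \<beta>_pos[of t] elim T by (auto simp: field_simps)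
      then have "\<bar>1 / \<theta> - \<alpha> - \<gamma> t\<bar> \<le> \<bar>1 / \<theta> - \<alpha>\<bar> + (1 + \<sigma>)" by (auto simp: \<gamma>_def)
      then show ?case by (simp add: abs_mult mult_right_mono)
    qed
    have "((\<lambda>t. (\<bar>1 / \<theta> - \<alpha>\<bar> + (1 + \<sigma>)) * \<bar>z t\<bar>) \<longlongrightarrow> (\<bar>1 / \<theta> - \<alpha>\<bar> + (1 + \<sigma>)) * \<bar>0\<bar>) at_top"
      by (intro tendsto_intros z)
    then show "((\<lambda>t. (\<bar>1 / \<theta> - \<alpha>\<bar> + (1 + \<sigma>)) * \<bar>z t\<bar>) \<longlongrightarrow> 0) at_top" by simp
  qed
  have \<epsilon>x: "((\<lambda>t. \<epsilon> t * inner (x t) y) \<longlongrightarrow> 0) at_top"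
  proof (rule Lim_null_comparison)
    show "\<forall>\<^sub>F t in at_top. norm (\<epsilon> t * inner (x t) y) \<le> \<epsilon> t * (M * norm y)"
      using M(1) eventually_ge_at_top[of T]
    proof eventually_elim
      case (elim t)
      then have "\<bar>inner (x t) y\<bar> \<le> M * norm y"
        using Cauchy_Schwarz_ineq2[of "x t" y] mult_right_mono[of "norm (x t)" M "norm y"] by simp
      then show ?case using \<epsilon>_nonneg[of t] elim by (simp add: abs_mult mult_left_mono)
    qed
    show "((\<lambda>t. \<epsilon> t * (M * norm y)) \<longlongrightarrow> 0) at_top"
      using tendsto_mult[OF \<epsilon>_lim tendsto_const[of "M * norm y"]] by simp
  qed
  have "(rhs \<longlongrightarrow> - inner 0 y - \<rho> * inner 0 (A y) - 0 + 0) at_top"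
    unfolding rhs_def by (intro tendsto_intros gradient_tendsto residual_tendsto \<epsilon>x \<gamma>z)
  then have rhs: "(rhs \<longlongrightarrow> 0) at_top" by simp
  have "((\<lambda>t. q t + z t / \<theta>) \<longlongrightarrow> 0 / 1) at_top"
  proof (rule ODE_tendsto[where T = T and \<theta> = \<theta>])
    fix t assume t: "t \<ge> T"
    have t0: "t > 0" using t T by simp
    have "((\<lambda>t. inner (x' t) y) has_real_derivative inner (x'' t) y) (at t)"
      using has_real_derivative_inner[OF x'_deriv[OF t] has_vector_derivative_const] by simp
    moreover have "((\<lambda>t. inner (l t - ls) (A y)) has_real_derivative inner (l' t) (A y)) (at t)"
      using has_real_derivative_inner[OF l_minus_ls_deriv[OF t] has_vector_derivative_const] by simp
    moreover have "t * \<beta> t \<noteq> 0" using t0 \<beta>_pos[OF t] by simp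
    ultimately show "((\<lambda>t. q t + z t / \<theta>) has_real_derivative
        inner (l' t) (A y) + (inner (x'' t) y / (t * \<beta> t) - \<gamma> t * z t / t) / \<theta>) (at t)"
      unfolding q_def z_def \<gamma>_def using \<theta> \<beta>_deriv[OF t] t0 \<beta>_pos[OF t]
      by (auto intro!: derivative_eq_intros simp: field_simps power2_eq_square)
  next
    have "\<forall>\<^sub>F t in at_top. \<theta> * t * (inner (l' t) (A y)
        + (inner (x'' t) y / (t * \<beta> t) - \<gamma> t * z t / t) / \<theta>) + 1 * (q t + z t / \<theta>) = rhs t"
      using eventually_ge_at_top[of T]
    proof eventually_elim
      case (elim t)
      have t: "t > 0" "\<beta> t > 0" using elim T \<beta>_pos by auto
      have "inner (x'' t + (\<alpha> / t) *\<^sub>R x' t) y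
        = - \<beta> t * (inner (g (x t) - g xs) y + q t + \<theta> * t * inner (l' t) (A y)
           + \<rho> * inner (A (x t) - b) (A y) + \<epsilon> t * inner (x t) y)"
        unfolding primal_eq[OF elim] using gradient_at_solution[of y]
        by (simp add: q_def inner_commute[of _ y] adjoint inner_add_right inner_diff_right
            inner_diff_left inner_add_left inner_commute[of _ "A y"])
      then have "inner (x'' t) y / \<beta> t + \<alpha> * z t
        = - (inner (g (x t) - g xs) y + q t + \<theta> * t * inner (l' t) (A y)
           + \<rho> * inner (A (x t) - b) (A y) + \<epsilon> t * inner (x t) y)"
        using t by (simp add: z_def inner_add_left field_simps)
      moreover have "\<theta> * t * (inner (l' t) (A y)
          + (inner (x'' t) y / (t * \<beta> t) - \<gamma> t * z t / t) / \<theta>)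
        = \<theta> * t * inner (l' t) (A y) + inner (x'' t) y / \<beta> t - \<gamma> t * z t"
        using t \<theta> by (simp add: field_simps)
      ultimately show ?case by (simp add: rhs_def algebra_simps)
    qed
    then show "((\<lambda>t. \<theta> * t * (inner (l' t) (A y)
        + (inner (x'' t) y / (t * \<beta> t) - \<gamma> t * z t / t) / \<theta>) + 1 * (q t + z t / \<theta>)) \<longlongrightarrow> 0) at_top"
      using rhs by (simp add: tendsto_cong)
  qed (use \<theta> in auto)
  \<comment> \<open>The corrector vanishes in the limit, so removing it gives the limit of
    \<open>q\<close>.\<close>
  then have "((\<lambda>t. (q t + z t / \<theta>) - z t / \<theta> + inner ls (A y)) \<longlongrightarrow> 0 / 1 - 0 / \<theta> + inner ls (A y)) at_top"
    using z \<theta> by (intro tendsto_intros) auto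
  then show ?thesis by (simp add: q_def inner_diff_left)
qed

section \<open>Optimality of weak cluster points\<close>

text \<open>Residual and \<open>inner (l t) (A y)\<close> have limits along the whole trajectory,
  which settles feasibility and the adjoint term. Weak lower semicontinuity makes the Bregman
  distance of \<open>xb\<close> from \<open>xs\<close> vanish, hence \<open>g xb = g xs\<close>
  although \<open>xb\<close> may differ from \<open>xs\<close>.\<close>

lemma cluster_point_KKT:
  assumes G: "G \<noteq> bot" "G \<le> at_top" and weak: "weakly_tendsto (\<lambda>t. (x t, l t)) (xb, lb) G"
  shows "g xb + adjoint A lb = 0 \<and> A xb = b"
proof -
  \<comment> \<open>Test vectors \<open>(u, q)\<close> with one component zero separate the two weak
    limits.\<close>
  have weak': "((\<lambda>t. inner (x t) u + inner (l t) q) \<longlongrightarrow> inner xb u + inner lb q) G" for u q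
    using weak unfolding weakly_tendsto_iff_inner by (auto simp: inner_prod_def dest: spec[of _ "(u, q)"])
  have x: "((\<lambda>t. inner (x t) u) \<longlongrightarrow> inner xb u) G" for u using weak'[of u 0] by simp
  have l: "((\<lambda>t. inner (l t) q) \<longlongrightarrow> inner lb q) G" for q using weak'[of 0 q] by simp
  have "inner (A xb - b) q = 0" for q
  proof (rule tendsto_unique[OF G(1)])
    have "((\<lambda>t. inner (x t) (adjoint A q) - inner b q) \<longlongrightarrow> inner xb (adjoint A q) - inner b q) G"
      by (intro tendsto_intros x)
    then show "((\<lambda>t. inner (A (x t) - b) q) \<longlongrightarrow> inner (A xb - b) q) G"
      by (simp add: adjoint inner_diff_left)
    have "((\<lambda>t. inner (A (x t) - b) q) \<longlongrightarrow> inner 0 q) G"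
      by (intro tendsto_intros tendsto_mono[OF G(2) residual_tendsto])
    then show "((\<lambda>t. inner (A (x t) - b) q) \<longlongrightarrow> 0) G" by simp
  qed
  from this[of "A xb - b"] have feasible: "A xb = b" by simp
  have lb: "inner lb (A u) = inner ls (A u)" for u
    by (rule tendsto_unique[OF G(1) l tendsto_mono[OF G(2) multiplier_tendsto]])
  \<comment> \<open>The tangent of \<open>f\<close> at \<open>xb\<close> is an affine, hence weakly
    continuous, minorant; this yields the lower semicontinuity at \<open>xb\<close>.\<close>
  have "bregman f g xb xs \<le> 0"
  proof (rule tendsto_lowerbound[OF _ _ G(1)])
    have "((\<lambda>t. bregman f g (x t) xs - (inner (x t) (g xb - g xs) - inner xb (g xb - g xs)))
        \<longlongrightarrow> 0 - (inner xb (g xb - g xs) - inner xb (g xb - g xs))) G"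
      by (intro tendsto_intros x tendsto_mono[OF G(2) bregman_tendsto])
    then show "((\<lambda>t. bregman f g (x t) xs - (inner (x t) (g xb - g xs) - inner xb (g xb - g xs)))
        \<longlongrightarrow> 0) G" by simp
    have "bregman f g xb xs \<le> bregman f g (x t) xs
        - (inner (x t) (g xb - g xs) - inner xb (g xb - g xs))" for t
      using gradient_inequality[OF f_convex f_grad, of xb "x t"]
      by (simp add: bregman_def inner_diff_left inner_diff_right inner_commute)
    then show "\<forall>\<^sub>F t in G. bregman f g xb xs \<le> bregman f g (x t) xs
        - (inner (x t) (g xb - g xs) - inner xb (g xb - g xs))" by simp
  qed
  then have "4 * L * bregman f g xb xs \<le> 0" using L by (simp add: mult_nonneg_nonpos)
  then have "(norm (g xb - g xs))\<^sup>2 \<le> 0"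
    using bregman_bound_gradient[OF f_convex f_grad L, of xb xs] by linarith
  then have "g xb = g xs" by simp
  then have "inner u (g xb + adjoint A lb) = 0" for u
    using gradient_at_solution[of u] lb[of u]
    by (simp add: inner_add_right adjoint inner_commute)
  from this[of "g xb + adjoint A lb"] feasible show ?thesis by simp
qed

lemma distance_tendsto: "\<exists>m. ((\<lambda>t. (norm ((x t, l t) - (xs, ls)))\<^sup>2) \<longlongrightarrow> m) at_top"
proof -
  obtain m where "(h \<longlongrightarrow> m) at_top" using h_tendsto by blast
  then have "((\<lambda>t. 2 * h t) \<longlongrightarrow> 2 * m) at_top" by (intro tendsto_intros)
  moreover have "(norm ((x t, l t) - (xs, ls)))\<^sup>2 = 2 * h t" for t
    by (simp add: h_def norm_Pair power2_norm_eq_inner)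
  ultimately show ?thesis by (simp only:) blast
qed

end

section \<open>Weak convergence of the trajectory\<close>

theorem theorem4p2:
  fixes f :: "'x::{real_inner,complete_space} \<Rightarrow> real"
    and gradf :: "'x \<Rightarrow> 'x"
    and A :: "'x \<Rightarrow> 'y::{real_inner,complete_space}"
    and b :: 'y
    and L t0 \<alpha> \<theta> \<rho> :: real
    and \<beta> \<beta>' \<epsilon> \<epsilon>' :: "real \<Rightarrow> real"
    and x :: "real \<Rightarrow> 'x" and l :: "real \<Rightarrow> 'y"
  assumes A: "bounded_linear A"
    and f_convex: "convex_on UNIV f"
    and f_grad: "\<And>u. GDERIV f u :> gradf u"
    and f_C1: "continuous_on UNIV gradf"
    and f_Lipschitz: "L > 0" "lipschitz_on L UNIV gradf"
    and t0: "t0 > 0"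
    and \<epsilon>_nonneg: "\<And>t. t \<ge> t0 \<Longrightarrow> \<epsilon> t \<ge> 0"
    and \<epsilon>_antimono: "antimono_on {t0..} \<epsilon>"
    and \<epsilon>_deriv: "\<And>t. t \<ge> t0 \<Longrightarrow> (\<epsilon> has_real_derivative \<epsilon>' t) (at t within {t0..})"
    and \<epsilon>_C1: "continuous_on {t0..} \<epsilon>'"
    and \<epsilon>_lim: "(\<epsilon> \<longlongrightarrow> 0) at_top"
    and \<beta>_pos: "\<And>t. t \<ge> t0 \<Longrightarrow> \<beta> t > 0"
    and \<beta>_mono: "mono_on {t0..} \<beta>"
    and \<beta>_deriv: "\<And>t. t \<ge> t0 \<Longrightarrow> (\<beta> has_real_derivative \<beta>' t) (at t within {t0..})"
    and \<beta>_C1: "continuous_on {t0..} \<beta>'"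
    and \<alpha>: "\<alpha> > 3"
    and \<theta>: "1 / (\<alpha> - 1) < \<theta>" "\<theta> < 1 / 2"
    and \<rho>: "\<rho> > 0"
    and \<Omega>_nonempty: "saddle_points f A b \<noteq> {}"
    and \<beta>_growth: "(SUP t\<in>{t0..}. ereal (t * \<beta>' t / \<beta> t)) < ereal ((1 - 2 * \<theta>) / \<theta>)"
    and \<epsilon>_integral: "(\<integral>\<^sup>+t\<in>{t0..}. ennreal (t * \<beta> t * \<epsilon> t) \<partial>lborel) < \<infinity>"
    and solution: "system_solution t0 \<alpha> \<theta> \<rho> \<beta> \<epsilon> gradf A b x l"
  shows "\<exists>w \<in> saddle_points f A b. weakly_tendsto (\<lambda>t. (x t, l t)) w at_top"
proof -
  \<comment> \<open>Beyond \<open>t0\<close> the derivatives within \<open>{t0..}\<close> are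
    two-sided, and from \<open>t0 + 1\<close> on the antiderivative is bounded; limits at infinity
    ignore the shift.\<close>
  define T where "T = t0 + 1"
  have at: "at t within {t0..} = at t" if "t \<ge> T" for t
    by (rule at_within_interior) (use that in \<open>simp add: T_def\<close>)
  obtain x' x'' l' l'' where sol: "\<And>t. t \<ge> t0 \<Longrightarrow>
      (x has_vector_derivative x' t) (at t within {t0..}) \<and>
      (x' has_vector_derivative x'' t) (at t within {t0..}) \<and>
      (l has_vector_derivative l' t) (at t within {t0..}) \<and>
      (l' has_vector_derivative l'' t) (at t within {t0..}) \<and>
      x'' t + (\<alpha> / t) *\<^sub>R x' t =
        - (\<beta> t *\<^sub>R (gradf (x t) + adjoint A (l t + (\<theta> * t) *\<^sub>R l' t)
                    + \<rho> *\<^sub>R adjoint A (A (x t) - b) + \<epsilon> t *\<^sub>R x t)) \<and>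
      l'' t + (\<alpha> / t) *\<^sub>R l' t = \<beta> t *\<^sub>R (A (x t + (\<theta> * t) *\<^sub>R x' t) - b)"
    using solution unfolding system_solution_def by blast
  have cont: "continuous_on {t0..} (\<lambda>t. t * \<beta> t * \<epsilon> t)"
    using \<beta>_deriv \<epsilon>_deriv
    by (intro continuous_intros) (auto simp: continuous_on_eq_continuous_within intro: DERIV_continuous)
  obtain P K where P: "\<And>t. t > t0 \<Longrightarrow> (P has_real_derivative t * \<beta> t * \<epsilon> t) (at t)"
      "\<And>t. t \<ge> T \<Longrightarrow> P t \<le> K"
  proof (rule nn_integral_antiderivative_bounded[OF cont _ \<epsilon>_integral])
    show "0 \<le> t * \<beta> t * \<epsilon> t" if "t \<ge> t0" for t
      using that t0 \<beta>_pos[OF that] \<epsilon>_nonneg[OF that] by simp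
  qed (auto simp: T_def)
  \<comment> \<open>A real number strictly between the supremum and its bound gives a growth
    estimate uniform in \<open>t\<close> with a strict margin.\<close>
  obtain \<sigma> where \<sigma>: "(SUP t\<in>{t0..}. ereal (t * \<beta>' t / \<beta> t)) < ereal \<sigma>"
      "ereal \<sigma> < ereal ((1 - 2 * \<theta>) / \<theta>)"
    using ereal_dense2[OF \<beta>_growth] by blast
  have growth: "t * \<beta>' t \<le> \<sigma> * \<beta> t" if "t \<ge> t0" for t
  proof -
    have "ereal (t * \<beta>' t / \<beta> t) \<le> (SUP t\<in>{t0..}. ereal (t * \<beta>' t / \<beta> t))"
      using that by (intro SUP_upper) auto
    then have "ereal (t * \<beta>' t / \<beta> t) < ereal \<sigma>" using \<sigma>(1) by (rule le_less_trans)
    then show ?thesis using \<beta>_pos[OF that] by (simp add: pos_divide_less_eq)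
  qed
  have \<theta>_pos: "\<theta> > 0" using less_trans[OF _ \<theta>(1), of 0] \<alpha> by simp
  have flow: "primal_dual_flow f gradf A b L T \<alpha> \<theta> \<rho> \<sigma> K \<beta> \<beta>' \<epsilon> \<epsilon>' P x x' x'' l l' l''"
  proof (rule primal_dual_flow.intro)
    show "\<theta> * \<sigma> < 1 - 2 * \<theta>"
      using \<sigma>(2) \<theta>_pos by (simp add: pos_less_divide_eq mult.commute)
    show "\<theta> * (\<alpha> - 1) > 1" using \<theta>(1) \<alpha> by (simp add: pos_divide_less_eq)
    fix t assume t: "t \<ge> T"
    then have tt: "t \<ge> t0" and int: "t \<in> interior {t0..}" by (auto simp: T_def)
    show \<epsilon>': "(\<epsilon> has_real_derivative \<epsilon>' t) (at t)" using \<epsilon>_deriv[OF tt] at[OF t] by simp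
    show \<beta>': "(\<beta> has_real_derivative \<beta>' t) (at t)" using \<beta>_deriv[OF tt] at[OF t] by simp
    show "\<beta>' t \<ge> 0" using mono_on_imp_deriv_nonneg[OF \<beta>_mono \<beta>' int] .
    have "mono_on {t0..} (\<lambda>t. - \<epsilon> t)" using \<epsilon>_antimono by (auto simp: monotone_on_def)
    from mono_on_imp_deriv_nonneg[OF this DERIV_minus[OF \<epsilon>'] int] show "\<epsilon>' t \<le> 0" by simp
    show "(P has_real_derivative t * \<beta> t * \<epsilon> t) (at t)" using P(1) t by (simp add: T_def)
    show "(x has_vector_derivative x' t) (at t)" "(x' has_vector_derivative x'' t) (at t)"
      "(l has_vector_derivative l' t) (at t)" "(l' has_vector_derivative l'' t) (at t)"
      "x'' t + (\<alpha> / t) *\<^sub>R x' t =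
        - (\<beta> t *\<^sub>R (gradf (x t) + adjoint A (l t + (\<theta> * t) *\<^sub>R l' t)
                    + \<rho> *\<^sub>R adjoint A (A (x t) - b) + \<epsilon> t *\<^sub>R x t))"
      "l'' t + (\<alpha> / t) *\<^sub>R l' t = \<beta> t *\<^sub>R (A (x t + (\<theta> * t) *\<^sub>R x' t) - b)"
      using sol[OF tt] unfolding at[OF t] by blast+
    show "\<epsilon> t \<ge> 0" "\<beta> t > 0" "t * \<beta>' t \<le> \<sigma> * \<beta> t" "P t \<le> K"
      using tt \<epsilon>_nonneg \<beta>_pos growth P(2)[OF t] by simp_all
  next
    show "T > 0" using t0 by (simp add: T_def)
  qed (fact A f_convex f_grad f_Lipschitz \<epsilon>_lim \<theta>_pos \<rho>)+
  \<comment> \<open>Opial's lemma asks for the distance to every saddle point, so each must be able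
    to serve as reference point.\<close>
  have flow_solution: "primal_dual_flow_solution f gradf A b L T \<alpha> \<theta> \<rho> \<sigma> K \<beta> \<beta>' \<epsilon> \<epsilon>' P
      x x' x'' l l' l'' xs ls" if "(xs, ls) \<in> saddle_points f A b" for xs ls
    using flow that saddle_points_iff_KKT[OF A f_convex f_grad]
    by (simp add: primal_dual_flow_solution_def primal_dual_flow_solution_axioms_def)
  show ?thesis
  proof (rule opial[OF _ \<Omega>_nonempty])
    fix p assume "p \<in> saddle_points f A b"
    then show "\<exists>r. ((\<lambda>t. (norm ((x t, l t) - p))\<^sup>2) \<longlongrightarrow> r) at_top"
      using primal_dual_flow_solution.distance_tendsto[OF flow_solution] by (cases p) blast
  next
    fix G p assume G: "G \<noteq> bot" "G \<le> at_top" "weakly_tendsto (\<lambda>t. (x t, l t)) p G"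
    \<comment> \<open>One reference point suffices for cluster points, since the KKT equations
      obtained are those of the cluster point itself.\<close>
    obtain xs ls where s: "(xs, ls) \<in> saddle_points f A b" using \<Omega>_nonempty by auto
    obtain xb lb where p: "p = (xb, lb)" by (cases p)
    show "p \<in> saddle_points f A b"
      using primal_dual_flow_solution.cluster_point_KKT[OF flow_solution[OF s] G(1,2)] G(3)
        saddle_points_iff_KKT[OF A f_convex f_grad] unfolding p by blast
  qed simp
qed

end
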